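(* Let $(\mathcal G,\rho,\omega)$ be a symplectic Lie--Rinehart--Jacobi algebra over $A$ with extension $(\widehat{\mathcal G}_\omega,\widehat\rho)$ and canonical form $\eta$. The map $\mathrm{Obs}:\mathfrak{ham}_{\mathrm{loc}}\to H^1_\rho(\mathcal G,A)$, $x\mapsto[i_x\omega]$, is a surjective morphism of Lie algebras onto the abelian Lie algebra $H^1_\rho(\mathcal G,A)$, with kernel $\mathfrak{ham}$. Hence there is an exact sequence of Lie algebras $$0\longrightarrow\mathfrak{ham}\longrightarrow\mathfrak{ham}_{\mathrm{loc}}\xrightarrow{\ \mathrm{Obs}\ }H^1_\rho(\mathcal G,A)\longrightarrow0,$$ and $\mathrm{Obs}(x)$ is exactly the obstruction to the strict lifting of $x$: for $x\in\mathfrak{ham}_{\mathrm{loc}}$, there exists $f\in A$ such that $x+fe$ is a strict symmetry of $\eta$ if and only if $\mathrm{Obs}(x)=0$.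
   Context: $K$ is a commutative field of characteristic zero and $A$ a commutative unital $K$-algebra; $L_a$ is multiplication by $a$. $\mathrm{Diff}^1_K(A)$ is the set of $K$-linear $D:A\to A$ with $[[D,L_a],L_b]=0$ for all $a,b\in A$. A Lie--Rinehart--Jacobi (LRJ) algebra over $A$ is an $A$-module $\mathcal G$ with a $K$-Lie algebra structure and an $A$-linear map (anchor) $\rho:\mathcal G\to\mathrm{Diff}^1_K(A)$ which is a Lie algebra morphism and satisfies $[x,ay]=a[x,y]+(\rho(x)(a)-a\rho(x)(1_A))y$. $C^p_\rho(\mathcal G,A)=\mathrm{Alt}^p_A(\mathcal G,A)$ is the module of alternating $A$-multilinear maps $\mathcal G^p\to A$, with differential $(d_\rho\beta)(x_0,\dots,x_p)=\sum_i(-1)^i\rho(x_i)\beta(x_0,\dots,\widehat{x_i},\dots,x_p)+\sum_{i<j}(-1)^{i+j}\beta([x_i,x_j],x_0,\dots,\widehat{x_i},\dots,\widehat{x_j},\dots,x_p)$; in particular $(d_\rho a)(x)=\rho(x)(a)$. $H^p_\rho(\mathcal G,A)$ denotes its cohomology. $i_x$ is the interior product and $\mathcal L^\rho_x=i_xd_\rho+d_\rho i_x$. The same notation is used for any LRJ algebra. A symplectic form on $(\mathcal G,\rho)$ is $\omega\in C^2_\rho(\mathcal G,A)$ with $d_\rho\omega=0$ and $\omega^\flat:\mathcal G\to\mathcal G^*=\mathrm{Hom}_A(\mathcal G,A)$, $x\mapsto i_x\omega$, an isomorphism of $A$-modules; $(\mathcal G,\rho,\omega)$ is then a symplectic LRJ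 algebra. The symplectic gradient $X_a\in\mathcal G$ of $a\in A$ is defined by $i_{X_a}\omega=d_\rho a$. $\mathfrak{ham}=\{X_a:a\in A\}$ (Hamiltonian elements) and $\mathfrak{ham}_{\mathrm{loc}}=\{x\in\mathcal G:\mathcal L^\rho_x\omega=0\}$ (locally Hamiltonian elements); since $d_\rho\omega=0$, $x\in\mathfrak{ham}_{\mathrm{loc}}$ iff $d_\rho(i_x\omega)=0$. $\mathfrak{ham}_{\mathrm{loc}}$ is a $K$-Lie subalgebra of $\mathcal G$ and $\mathfrak{ham}$ is an ideal of it. The extension: $\widehat{\mathcal G}_\omega=\mathcal G\oplus Ae$ with $e$ generating a free summand of rank one, with bracket $[x+fe,y+ge]_\omega=[x,y]+(\rho(x)(g)-\rho(y)(f)+\omega(x,y))e$, anchor $\widehat\rho(x+fe)=\rho(x)$, projection $\pi(x+fe)=x$ and canonical form $\eta(x+fe)=f$. $(\widehat{\mathcal G}_\omega,\widehat\rho)$ is an LRJ algebra. An element $u\in\widehat{\mathcal G}_\omega$ is a strict symmetry of $\eta$ if $\mathcal L^{\widehat\rho}_u\eta=0$. *)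

theory Defs
  imports "HOL-Algebra.Module" "HOL-Algebra.AbelCoset"
begin

section \<open>Lie algebras with explicit carriers\<close>

record ('r, 'l) lie_module = "('r, 'l) module" +
  lie_bracket :: "'l \<Rightarrow> 'l \<Rightarrow> 'l"

text \<open>The fields \<open>mult\<close> and \<open>one\<close>, inherited from the ring record through the module record,
  carry no meaning for modules and are left \<open>undefined\<close> in the constructions below.\<close>

locale lie_algebra = field K + module K L
  for K :: "('k, 'm) ring_scheme" (structure) and L :: "('k, 'l, 'n) lie_module_scheme" (structure) +
  assumes bracket_closed:
      "\<lbrakk>x \<in> carrier L; y \<in> carrier L\<rbrakk> \<Longrightarrow> lie_bracket L x y \<in> carrier L"
    and bracket_add_left:
      "\<lbrakk>x \<in> carrier L; y \<in> carrier L; z \<in> carrier L\<rbrakk> \<Longrightarrow>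
        lie_bracket L (x \<oplus>\<^bsub>L\<^esub> y) z = lie_bracket L x z \<oplus>\<^bsub>L\<^esub> lie_bracket L y z"
    and bracket_add_right:
      "\<lbrakk>x \<in> carrier L; y \<in> carrier L; z \<in> carrier L\<rbrakk> \<Longrightarrow>
        lie_bracket L x (y \<oplus>\<^bsub>L\<^esub> z) = lie_bracket L x y \<oplus>\<^bsub>L\<^esub> lie_bracket L x z"
    and bracket_smult_left:
      "\<lbrakk>k \<in> carrier K; x \<in> carrier L; y \<in> carrier L\<rbrakk> \<Longrightarrow>
        lie_bracket L (k \<odot>\<^bsub>L\<^esub> x) y = k \<odot>\<^bsub>L\<^esub> lie_bracket L x y"
    and bracket_smult_right:
      "\<lbrakk>k \<in> carrier K; x \<in> carrier L; y \<in> carrier L\<rbrakk> \<Longrightarrow>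
        lie_bracket L x (k \<odot>\<^bsub>L\<^esub> y) = k \<odot>\<^bsub>L\<^esub> lie_bracket L x y"
    and bracket_self: "x \<in> carrier L \<Longrightarrow> lie_bracket L x x = \<zero>\<^bsub>L\<^esub>"
    and jacobi:
      "\<lbrakk>x \<in> carrier L; y \<in> carrier L; z \<in> carrier L\<rbrakk> \<Longrightarrow>
        lie_bracket L x (lie_bracket L y z) \<oplus>\<^bsub>L\<^esub> lie_bracket L y (lie_bracket L z x)
          \<oplus>\<^bsub>L\<^esub> lie_bracket L z (lie_bracket L x y) = \<zero>\<^bsub>L\<^esub>"

definition abelian_lie :: "('k, 'l, 'n) lie_module_scheme \<Rightarrow> bool" where
  "abelian_lie L \<longleftrightarrow> (\<forall>x\<in>carrier L. \<forall>y\<in>carrier L. lie_bracket L x y = \<zero>\<^bsub>L\<^esub>)"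

definition linear_maps ::
  "('r, 'm) ring_scheme \<Rightarrow> ('r, 'a, 'n) module_scheme \<Rightarrow> ('r, 'b, 'o) module_scheme \<Rightarrow> ('a \<Rightarrow> 'b) set"
  where "linear_maps R M N = {f \<in> carrier M \<rightarrow> carrier N.
    (\<forall>x\<in>carrier M. \<forall>y\<in>carrier M. f (x \<oplus>\<^bsub>M\<^esub> y) = f x \<oplus>\<^bsub>N\<^esub> f y) \<and>
    (\<forall>r\<in>carrier R. \<forall>x\<in>carrier M. f (r \<odot>\<^bsub>M\<^esub> x) = r \<odot>\<^bsub>N\<^esub> f x)}"

definition lie_hom ::
  "('k, 'm) ring_scheme \<Rightarrow> ('k, 'a, 'n) lie_module_scheme \<Rightarrow> ('k, 'b, 'o) lie_module_scheme
    \<Rightarrow> ('a \<Rightarrow> 'b) set"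
  where "lie_hom K L M = {f \<in> linear_maps K L M.
    \<forall>x\<in>carrier L. \<forall>y\<in>carrier L. f (lie_bracket L x y) = lie_bracket M (f x) (f y)}"

definition lie_short_exact ::
  "('k, 'm) ring_scheme \<Rightarrow> ('k, 'a, 'n) lie_module_scheme \<Rightarrow> ('a \<Rightarrow> 'b)
    \<Rightarrow> ('k, 'b, 'o) lie_module_scheme \<Rightarrow> ('b \<Rightarrow> 'c) \<Rightarrow> ('k, 'c, 'p) lie_module_scheme \<Rightarrow> bool"
  where "lie_short_exact K L f M g N \<longleftrightarrow>
    lie_algebra K L \<and> lie_algebra K M \<and> lie_algebra K N \<and>
    f \<in> lie_hom K L M \<and> g \<in> lie_hom K M N \<and>
    inj_on f (carrier L) \<and>
    f ` carrier L = {y \<in> carrier M. g y = \<zero>\<^bsub>N\<^esub>} \<and>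
    g ` carrier M = carrier N"


section \<open>Modules over a commutative algebra\<close>

definition self_module :: "('a, 'm) ring_scheme \<Rightarrow> ('a, 'a) module" where
  "self_module A = \<lparr>carrier = carrier A, mult = mult A, one = one A, zero = zero A, add = add A,
    smult = mult A\<rparr>"

text \<open>The \<open>K\<close>-space (with bracket) underlying an \<open>A\<close>-module, through \<open>k \<mapsto> k \<cdot> 1\<close>.\<close>

definition restrict_scalars ::
  "('k, 'a, 'm) module_scheme \<Rightarrow> ('a, 'g, 'n) lie_module_scheme \<Rightarrow> ('k, 'g) lie_module"
  where "restrict_scalars A G = \<lparr>carrier = carrier G, mult = mult G, one = one G, zero = zero G,
    add = add G, smult = (\<lambda>k x. (k \<odot>\<^bsub>A\<^esub> \<one>\<^bsub>A\<^esub>) \<odot>\<^bsub>G\<^esub> x), lie_bracket = lie_bracket G\<rparr>"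

text \<open>The dual module \<open>Hom\<^sub>A(G, A)\<close>; functions are extensional so that equality of functions is
  equality of maps on the carrier.\<close>

definition dual_module :: "('a, 'm) ring_scheme \<Rightarrow> ('a, 'g, 'n) module_scheme \<Rightarrow> ('a, 'g \<Rightarrow> 'a) module"
  where "dual_module A G = \<lparr>carrier = linear_maps A G (self_module A) \<inter> extensional (carrier G),
    mult = undefined, one = undefined,
    zero = (\<lambda>x\<in>carrier G. \<zero>\<^bsub>A\<^esub>),
    add = (\<lambda>f g. \<lambda>x\<in>carrier G. f x \<oplus>\<^bsub>A\<^esub> g x),
    smult = (\<lambda>a f. \<lambda>x\<in>carrier G. a \<otimes>\<^bsub>A\<^esub> f x)\<rparr>"

definition commutator :: "('a, 'm) ring_scheme \<Rightarrow> ('a \<Rightarrow> 'a) \<Rightarrow> ('a \<Rightarrow> 'a) \<Rightarrow> 'a \<Rightarrow> 'a" where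
  "commutator A S T = (\<lambda>b\<in>carrier A. S (T b) \<ominus>\<^bsub>A\<^esub> T (S b))"

definition mult_op :: "('a, 'm) ring_scheme \<Rightarrow> 'a \<Rightarrow> 'a \<Rightarrow> 'a" where
  "mult_op A a = (\<lambda>b\<in>carrier A. a \<otimes>\<^bsub>A\<^esub> b)"

text \<open>Differential operators of order at most one (again extensional), with the \<open>A\<close>-module
  structure \<open>(a D)(b) = a D(b)\<close> and the commutator bracket.\<close>

definition Diff1 ::
  "('k, 'm) ring_scheme \<Rightarrow> ('k, 'a, 'n) module_scheme \<Rightarrow> ('a, 'a \<Rightarrow> 'a) lie_module"
  where "Diff1 K A = \<lparr>
    carrier = {D \<in> linear_maps K A A \<inter> extensional (carrier A).
      \<forall>a\<in>carrier A. \<forall>b\<in>carrier A.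
        commutator A (commutator A D (mult_op A a)) (mult_op A b) = (\<lambda>c\<in>carrier A. \<zero>\<^bsub>A\<^esub>)},
    mult = undefined, one = undefined,
    zero = (\<lambda>b\<in>carrier A. \<zero>\<^bsub>A\<^esub>),
    add = (\<lambda>D E. \<lambda>b\<in>carrier A. D b \<oplus>\<^bsub>A\<^esub> E b),
    smult = (\<lambda>a D. \<lambda>b\<in>carrier A. a \<otimes>\<^bsub>A\<^esub> D b),
    lie_bracket = commutator A\<rparr>"


section \<open>Lie--Rinehart--Jacobi algebras\<close>

locale lrj_algebra = field K + algebra K A + G: module A G
  for K :: "('k, 'm) ring_scheme" (structure)
    and A :: "('k, 'a, 'n) module_scheme" (structure)
    and G :: "('a, 'g, 'o) lie_module_scheme" (structure) +
  fixes \<rho> :: "'g \<Rightarrow> 'a \<Rightarrow> 'a"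
  assumes char_zero: "\<And>n::nat. n > 0 \<Longrightarrow> [n] \<cdot>\<^bsub>K\<^esub> \<one>\<^bsub>K\<^esub> \<noteq> \<zero>\<^bsub>K\<^esub>"
    and lie_algebra: "lie_algebra K (restrict_scalars A G)"
    and anchor_linear: "\<rho> \<in> linear_maps A G (Diff1 K A)"
    and anchor_lie_hom: "\<rho> \<in> lie_hom K (restrict_scalars A G) (restrict_scalars A (Diff1 K A))"
    and leibniz: "\<lbrakk>x \<in> carrier G; y \<in> carrier G; a \<in> carrier A\<rbrakk> \<Longrightarrow>
      lie_bracket G x (a \<odot>\<^bsub>G\<^esub> y) =
        a \<odot>\<^bsub>G\<^esub> lie_bracket G x y \<oplus>\<^bsub>G\<^esub> (\<rho> x a \<ominus>\<^bsub>A\<^esub> a \<otimes>\<^bsub>A\<^esub> \<rho> x \<one>\<^bsub>A\<^esub>) \<odot>\<^bsub>G\<^esub> y"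


section \<open>Cochains and cohomology\<close>

text \<open>A \<open>p\<close>-cochain is a function on argument lists, extended by \<open>\<zero>\<close> to all lists which are not
  lists of \<open>p\<close> elements of \<open>G\<close>. With this convention the differential and the interior product are
  given by formulas that do not mention the degree.\<close>

definition tuples :: "nat \<Rightarrow> ('a, 'g, 'o) module_scheme \<Rightarrow> 'g list set" where
  "tuples p G = {xs. length xs = p \<and> set xs \<subseteq> carrier G}"

definition cochains ::
  "('a, 'm) ring_scheme \<Rightarrow> ('a, 'g, 'o) module_scheme \<Rightarrow> nat \<Rightarrow> ('g list \<Rightarrow> 'a) set"
  where "cochains A G p = {\<beta>.
    (\<forall>xs. xs \<notin> tuples p G \<longrightarrow> \<beta> xs = \<zero>\<^bsub>A\<^esub>) \<and>
    (\<forall>xs\<in>tuples p G. \<beta> xs \<in> carrier A) \<and>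
    (\<forall>xs\<in>tuples p G. \<forall>i<p. \<forall>x\<in>carrier G. \<forall>y\<in>carrier G.
      \<beta> (xs[i := x \<oplus>\<^bsub>G\<^esub> y]) = \<beta> (xs[i := x]) \<oplus>\<^bsub>A\<^esub> \<beta> (xs[i := y])) \<and>
    (\<forall>xs\<in>tuples p G. \<forall>i<p. \<forall>a\<in>carrier A. \<forall>x\<in>carrier G.
      \<beta> (xs[i := a \<odot>\<^bsub>G\<^esub> x]) = a \<otimes>\<^bsub>A\<^esub> \<beta> (xs[i := x])) \<and>
    (\<forall>xs\<in>tuples p G. \<forall>i j. i < j \<and> j < p \<and> xs ! i = xs ! j \<longrightarrow> \<beta> xs = \<zero>\<^bsub>A\<^esub>)}"

definition zero_cochain :: "('a, 'm) ring_scheme \<Rightarrow> 'g list \<Rightarrow> 'a" where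
  "zero_cochain A = (\<lambda>xs. \<zero>\<^bsub>A\<^esub>)"

definition add_cochain ::
  "('a, 'm) ring_scheme \<Rightarrow> ('g list \<Rightarrow> 'a) \<Rightarrow> ('g list \<Rightarrow> 'a) \<Rightarrow> 'g list \<Rightarrow> 'a"
  where "add_cochain A \<beta> \<gamma> = (\<lambda>xs. \<beta> xs \<oplus>\<^bsub>A\<^esub> \<gamma> xs)"

text \<open>An element of \<open>A\<close> as a \<open>0\<close>-cochain.\<close>

definition const_cochain :: "('a, 'm) ring_scheme \<Rightarrow> 'a \<Rightarrow> 'g list \<Rightarrow> 'a" where
  "const_cochain A a = (\<lambda>xs. if xs = [] then a else \<zero>\<^bsub>A\<^esub>)"

text \<open>\<^term>\<open>nths xs (- I)\<close> is the list \<^term>\<open>xs\<close> with the entries at positions in \<^term>\<open>I\<close> omitted.\<close>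

definition differential ::
  "('a, 'm) ring_scheme \<Rightarrow> ('a, 'g, 'o) lie_module_scheme \<Rightarrow> ('g \<Rightarrow> 'a \<Rightarrow> 'a)
    \<Rightarrow> ('g list \<Rightarrow> 'a) \<Rightarrow> 'g list \<Rightarrow> 'a"
  where "differential A G \<rho> \<beta> = (\<lambda>xs. if set xs \<subseteq> carrier G then
      (\<Oplus>\<^bsub>A\<^esub>i\<in>{..<length xs}.
        (\<ominus>\<^bsub>A\<^esub> \<one>\<^bsub>A\<^esub>) [^]\<^bsub>A\<^esub> i \<otimes>\<^bsub>A\<^esub> \<rho> (xs ! i) (\<beta> (nths xs (- {i}))))
      \<oplus>\<^bsub>A\<^esub>
      (\<Oplus>\<^bsub>A\<^esub>j\<in>{..<length xs}. \<Oplus>\<^bsub>A\<^esub>i\<in>{..<j}.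
        (\<ominus>\<^bsub>A\<^esub> \<one>\<^bsub>A\<^esub>) [^]\<^bsub>A\<^esub> (i + j) \<otimes>\<^bsub>A\<^esub>
          \<beta> (lie_bracket G (xs ! i) (xs ! j) # nths xs (- {i, j})))
    else \<zero>\<^bsub>A\<^esub>)"

definition interior :: "'g \<Rightarrow> ('g list \<Rightarrow> 'a) \<Rightarrow> 'g list \<Rightarrow> 'a" where
  "interior x \<beta> = (\<lambda>xs. \<beta> (x # xs))"

definition lie_derivative ::
  "('a, 'm) ring_scheme \<Rightarrow> ('a, 'g, 'o) lie_module_scheme \<Rightarrow> ('g \<Rightarrow> 'a \<Rightarrow> 'a)
    \<Rightarrow> 'g \<Rightarrow> ('g list \<Rightarrow> 'a) \<Rightarrow> 'g list \<Rightarrow> 'a"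
  where "lie_derivative A G \<rho> x \<beta> =
    add_cochain A (interior x (differential A G \<rho> \<beta>)) (differential A G \<rho> (interior x \<beta>))"

definition cocycles ::
  "('a, 'm) ring_scheme \<Rightarrow> ('a, 'g, 'o) lie_module_scheme \<Rightarrow> ('g \<Rightarrow> 'a \<Rightarrow> 'a) \<Rightarrow> nat
    \<Rightarrow> ('g list \<Rightarrow> 'a) set"
  where "cocycles A G \<rho> p = {\<beta> \<in> cochains A G p. differential A G \<rho> \<beta> = zero_cochain A}"

definition coboundaries ::
  "('a, 'm) ring_scheme \<Rightarrow> ('a, 'g, 'o) lie_module_scheme \<Rightarrow> ('g \<Rightarrow> 'a \<Rightarrow> 'a) \<Rightarrow> nat
    \<Rightarrow> ('g list \<Rightarrow> 'a) set"
  where "coboundaries A G \<rho> p =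
    (if p = 0 then {zero_cochain A} else differential A G \<rho> ` cochains A G (p - 1))"

definition cocycle_space ::
  "('k, 'a, 'm) module_scheme \<Rightarrow> ('a, 'g, 'o) lie_module_scheme \<Rightarrow> ('g \<Rightarrow> 'a \<Rightarrow> 'a) \<Rightarrow> nat
    \<Rightarrow> ('k, 'g list \<Rightarrow> 'a) module"
  where "cocycle_space A G \<rho> p = \<lparr>carrier = cocycles A G \<rho> p, mult = undefined, one = undefined,
    zero = zero_cochain A, add = add_cochain A, smult = (\<lambda>k \<beta> xs. k \<odot>\<^bsub>A\<^esub> \<beta> xs)\<rparr>"

definition cohomology_class ::
  "('k, 'a, 'm) module_scheme \<Rightarrow> ('a, 'g, 'o) lie_module_scheme \<Rightarrow> ('g \<Rightarrow> 'a \<Rightarrow> 'a) \<Rightarrow> nat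
    \<Rightarrow> ('g list \<Rightarrow> 'a) \<Rightarrow> ('g list \<Rightarrow> 'a) set"
  where "cohomology_class A G \<rho> p \<beta> = coboundaries A G \<rho> p +>\<^bsub>cocycle_space A G \<rho> p\<^esub> \<beta>"

text \<open>The quotient of cocycles by coboundaries, as a \<open>K\<close>-space with zero bracket. Scalars act on a
  coset \<open>C\<close> by \<open>k C + B\<close> (rather than \<open>k C\<close>, which would be wrong for \<open>k = 0\<close>).\<close>

definition cohomology ::
  "('k, 'a, 'm) module_scheme \<Rightarrow> ('a, 'g, 'o) lie_module_scheme \<Rightarrow> ('g \<Rightarrow> 'a \<Rightarrow> 'a) \<Rightarrow> nat
    \<Rightarrow> ('k, ('g list \<Rightarrow> 'a) set) lie_module"
  where "cohomology A G \<rho> p = (let Z = cocycle_space A G \<rho> p; B = coboundaries A G \<rho> p in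
    \<lparr>carrier = a_rcosets\<^bsub>Z\<^esub> B, mult = undefined, one = undefined,
      zero = B, add = set_add Z,
      smult = (\<lambda>k C. B <+>\<^bsub>Z\<^esub> ((\<lambda>\<beta>. k \<odot>\<^bsub>Z\<^esub> \<beta>) ` C)),
      lie_bracket = (\<lambda>C D. B)\<rparr>)"


section \<open>Symplectic structures\<close>

text \<open>The map \<open>x \<mapsto> i\<^sub>x \<omega>\<close> into the dual module (a \<open>1\<close>-cochain read as a function on \<open>G\<close>).\<close>

definition flat ::
  "('a, 'g, 'o) lie_module_scheme \<Rightarrow> ('g list \<Rightarrow> 'a) \<Rightarrow> 'g \<Rightarrow> 'g \<Rightarrow> 'a"
  where "flat G \<omega> x = (\<lambda>y\<in>carrier G. interior x \<omega> [y])"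

locale symplectic_lrj_algebra = lrj_algebra K A G \<rho>
  for K :: "('k, 'm) ring_scheme" (structure)
    and A :: "('k, 'a, 'n) module_scheme" (structure)
    and G :: "('a, 'g, 'o) lie_module_scheme" (structure)
    and \<rho> :: "'g \<Rightarrow> 'a \<Rightarrow> 'a" +
  fixes \<omega> :: "'g list \<Rightarrow> 'a"
  assumes omega_cochain: "\<omega> \<in> cochains A G 2"
    and omega_closed: "differential A G \<rho> \<omega> = zero_cochain A"
    and flat_linear: "flat G \<omega> \<in> linear_maps A G (dual_module A G)"
    and flat_bij: "bij_betw (flat G \<omega>) (carrier G) (carrier (dual_module A G))"

definition symplectic_gradient ::
  "('a, 'm) ring_scheme \<Rightarrow> ('a, 'g, 'o) lie_module_scheme \<Rightarrow> ('g \<Rightarrow> 'a \<Rightarrow> 'a) \<Rightarrow> ('g list \<Rightarrow> 'a)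
    \<Rightarrow> 'a \<Rightarrow> 'g"
  where "symplectic_gradient A G \<rho> \<omega> a =
    (THE x. x \<in> carrier G \<and> interior x \<omega> = differential A G \<rho> (const_cochain A a))"

definition hamiltonian ::
  "('a, 'm) ring_scheme \<Rightarrow> ('a, 'g, 'o) lie_module_scheme \<Rightarrow> ('g \<Rightarrow> 'a \<Rightarrow> 'a) \<Rightarrow> ('g list \<Rightarrow> 'a)
    \<Rightarrow> 'g set"
  where "hamiltonian A G \<rho> \<omega> = symplectic_gradient A G \<rho> \<omega> ` carrier A"

definition loc_hamiltonian ::
  "('a, 'm) ring_scheme \<Rightarrow> ('a, 'g, 'o) lie_module_scheme \<Rightarrow> ('g \<Rightarrow> 'a \<Rightarrow> 'a) \<Rightarrow> ('g list \<Rightarrow> 'a)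
    \<Rightarrow> 'g set"
  where "loc_hamiltonian A G \<rho> \<omega> = {x \<in> carrier G. lie_derivative A G \<rho> x \<omega> = zero_cochain A}"

definition ham_lie ::
  "('k, 'a, 'm) module_scheme \<Rightarrow> ('a, 'g, 'o) lie_module_scheme \<Rightarrow> ('g \<Rightarrow> 'a \<Rightarrow> 'a)
    \<Rightarrow> ('g list \<Rightarrow> 'a) \<Rightarrow> ('k, 'g) lie_module"
  where "ham_lie A G \<rho> \<omega> = (restrict_scalars A G)\<lparr>carrier := hamiltonian A G \<rho> \<omega>\<rparr>"

definition ham_loc_lie ::
  "('k, 'a, 'm) module_scheme \<Rightarrow> ('a, 'g, 'o) lie_module_scheme \<Rightarrow> ('g \<Rightarrow> 'a \<Rightarrow> 'a)
    \<Rightarrow> ('g list \<Rightarrow> 'a) \<Rightarrow> ('k, 'g) lie_module"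
  where "ham_loc_lie A G \<rho> \<omega> = (restrict_scalars A G)\<lparr>carrier := loc_hamiltonian A G \<rho> \<omega>\<rparr>"

definition Obs ::
  "('k, 'a, 'm) module_scheme \<Rightarrow> ('a, 'g, 'o) lie_module_scheme \<Rightarrow> ('g \<Rightarrow> 'a \<Rightarrow> 'a)
    \<Rightarrow> ('g list \<Rightarrow> 'a) \<Rightarrow> 'g \<Rightarrow> ('g list \<Rightarrow> 'a) set"
  where "Obs A G \<rho> \<omega> x = cohomology_class A G \<rho> 1 (interior x \<omega>)"


section \<open>The extension\<close>

text \<open>The pair \<open>(x, f)\<close> stands for \<open>x + f e\<close>.\<close>

definition extension ::
  "('a, 'm) ring_scheme \<Rightarrow> ('a, 'g, 'o) lie_module_scheme \<Rightarrow> ('g \<Rightarrow> 'a \<Rightarrow> 'a) \<Rightarrow> ('g list \<Rightarrow> 'a)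
    \<Rightarrow> ('a, 'g \<times> 'a) lie_module"
  where "extension A G \<rho> \<omega> = \<lparr>carrier = carrier G \<times> carrier A,
    mult = undefined, one = undefined,
    zero = (\<zero>\<^bsub>G\<^esub>, \<zero>\<^bsub>A\<^esub>),
    add = (\<lambda>(x, f) (y, g). (x \<oplus>\<^bsub>G\<^esub> y, f \<oplus>\<^bsub>A\<^esub> g)),
    smult = (\<lambda>a (x, f). (a \<odot>\<^bsub>G\<^esub> x, a \<otimes>\<^bsub>A\<^esub> f)),
    lie_bracket = (\<lambda>(x, f) (y, g).
      (lie_bracket G x y, (\<rho> x g \<ominus>\<^bsub>A\<^esub> \<rho> y f) \<oplus>\<^bsub>A\<^esub> \<omega> [x, y]))\<rparr>"

definition ext_anchor :: "('g \<Rightarrow> 'a \<Rightarrow> 'a) \<Rightarrow> 'g \<times> 'a \<Rightarrow> 'a \<Rightarrow> 'a" where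
  "ext_anchor \<rho> u = \<rho> (fst u)"

definition canonical_form ::
  "('a, 'm) ring_scheme \<Rightarrow> ('a, 'g, 'o) lie_module_scheme \<Rightarrow> ('g \<times> 'a) list \<Rightarrow> 'a"
  where "canonical_form A G = (\<lambda>us.
    if length us = 1 \<and> set us \<subseteq> carrier G \<times> carrier A then snd (hd us) else \<zero>\<^bsub>A\<^esub>)"

definition strict_symmetry ::
  "('a, 'm) ring_scheme \<Rightarrow> ('a, 'g, 'o) lie_module_scheme \<Rightarrow> ('g \<Rightarrow> 'a \<Rightarrow> 'a) \<Rightarrow> ('g list \<Rightarrow> 'a)
    \<Rightarrow> 'g \<times> 'a \<Rightarrow> bool"
  where "strict_symmetry A G \<rho> \<omega> u \<longleftrightarrow> u \<in> carrier (extension A G \<rho> \<omega>) \<and>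
    lie_derivative A (extension A G \<rho> \<omega>) (ext_anchor \<rho>) u (canonical_form A G) = zero_cochain A"

end

theory Submission
  imports Defs
begin

text \<open>
  Since \<open>d\<omega> = 0\<close>, Cartan's formula gives \<open>L\<^sub>x\<omega> = d(i\<^sub>x\<omega>)\<close>. Nondegeneracy turns \<open>x \<mapsto> i\<^sub>x\<omega>\<close> into a
  \<open>K\<close>-linear bijection from \<open>G\<close> to the one-cochains, under which the locally Hamiltonian elements
  correspond to the one-cocycles (\<open>loc_hamiltonian_iff\<close>) and the Hamiltonian elements to the
  one-coboundaries (\<open>hamiltonian_iff\<close>). The obstruction map is this bijection followed by the
  quotient map from cocycles to cohomology, so it is onto and its kernel consists of the
  Hamiltonian elements.

  Compatibility with the brackets rests on one computation (\<open>bracket_hamiltonian\<close>): for locally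
  Hamiltonian \<open>x\<close> and \<open>y\<close>, the closedness of \<open>\<omega>\<close>, evaluated on \<open>(x, y, z)\<close>, collapses to
  \<open>\<omega>([x, y], z) = - \<rho>(z)(\<omega>(x, y))\<close>. So \<open>[x, y]\<close> is the symplectic gradient of \<open>- \<omega>(x, y)\<close>. This one
  fact makes both kinds of Hamiltonian elements closed under the bracket and sends every bracket to
  the zero class, in agreement with the zero bracket on cohomology.

  For the lifting statement, the Lie derivative of the canonical form \<open>\<eta>\<close> along \<open>x + f e\<close> has the
  value \<open>\<rho>(y)(f) - \<omega>(x, y)\<close> at \<open>y + g e\<close>: the contributions of \<open>g\<close> cancel. It vanishes exactly when
  \<open>i\<^sub>x\<omega> = df\<close> (\<open>strict_symmetry_iff\<close>), so \<open>x\<close> has a strict lift if and only if it is Hamiltonian.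

  Both the algebra and its extension need the differential only in low degree, so the explicit
  formulas are derived once, under assumptions that both satisfy (\<open>anchored_bracket\<close>).
\<close>

section \<open>Subspaces and quotients\<close>

text \<open>Closure under negation comes for free, because \<open>- x = (- 1) x\<close>.\<close>

lemma (in module) submodule_criterion:
  assumes sub: "S \<subseteq> carrier M" and zero: "\<zero>\<^bsub>M\<^esub> \<in> S"
    and add: "\<And>x y. \<lbrakk>x \<in> S; y \<in> S\<rbrakk> \<Longrightarrow> x \<oplus>\<^bsub>M\<^esub> y \<in> S"
    and smult: "\<And>a x. \<lbrakk>a \<in> carrier R; x \<in> S\<rbrakk> \<Longrightarrow> a \<odot>\<^bsub>M\<^esub> x \<in> S"
  shows "submodule S R M"
proof (rule submoduleI)
  fix x assume x: "x \<in> S"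
  then have "\<ominus>\<^bsub>M\<^esub> x = (\<ominus> \<one>) \<odot>\<^bsub>M\<^esub> x"
    using sub by (auto simp: smult_l_minus)
  then show "\<ominus>\<^bsub>M\<^esub> x \<in> S" using smult[of "\<ominus> \<one>" x] x by simp
qed (use assms in auto)

lemma (in lie_algebra) lie_subalgebra:
  assumes S: "submodule S K L"
    and br: "\<And>x y. \<lbrakk>x \<in> S; y \<in> S\<rbrakk> \<Longrightarrow> lie_bracket L x y \<in> S"
  shows "lie_algebra K (L\<lparr>carrier := S\<rparr>)"
proof -
  have sub: "x \<in> S \<Longrightarrow> x \<in> carrier L" for x
    using submoduleE(1)[OF S] by auto
  have m: "module K (L\<lparr>carrier := S\<rparr>)"
    by (rule submodule.submodule_is_module[OF S]) (rule module_axioms)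
  show ?thesis
    by (intro lie_algebra.intro m lie_algebra_axioms.intro)
      (use field_axioms sub br in \<open>auto simp: bracket_add_left bracket_add_right
        bracket_smult_left bracket_smult_right bracket_self jacobi\<close>)
qed

text \<open>The quotient is described through its fields rather than as a concrete record, so that the
  result applies to records with additional fields such as a bracket. The scalar action
  \<open>C \<mapsto> B + k C\<close> is well defined on cosets, and sends \<open>B + x\<close> to \<open>B + k x\<close>, because \<open>k B \<subseteq> B\<close>.\<close>

lemma (in module) quotient_module:
  fixes Q :: "('a, 'c set, 'q) module_scheme"
  assumes S: "submodule B R M"
    and Q: "carrier Q = a_rcosets\<^bsub>M\<^esub> B" "\<zero>\<^bsub>Q\<^esub> = B" "add Q = set_add M"
      "\<And>k C. k \<odot>\<^bsub>Q\<^esub> C = B <+>\<^bsub>M\<^esub> ((\<lambda>x. k \<odot>\<^bsub>M\<^esub> x) ` C)"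
  shows quotient_module_axioms: "module R Q"
    and quotient_smult: "\<lbrakk>k \<in> carrier R; x \<in> carrier M\<rbrakk> \<Longrightarrow>
      k \<odot>\<^bsub>Q\<^esub> (B +>\<^bsub>M\<^esub> x) = B +>\<^bsub>M\<^esub> (k \<odot>\<^bsub>M\<^esub> x)"
proof -
  have B: "abelian_subgroup B M"
    by (rule abelian_subgroupI3)
      (use S M.abelian_group_axioms in \<open>auto simp: additive_subgroup_def submodule_def\<close>)
  interpret B: abelian_subgroup B M by (rule B)
  have carr: "carrier Q = {B +>\<^bsub>M\<^esub> x | x. x \<in> carrier M}"
    by (auto simp: Q A_RCOSETS_def RCOSETS_def a_r_coset_def)
  have rep: "\<exists>x\<in>carrier M. C = B +>\<^bsub>M\<^esub> x" if "C \<in> carrier Q" for C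
    using that carr by auto
  have inQ: "B +>\<^bsub>M\<^esub> x \<in> carrier Q" if "x \<in> carrier M" for x
    using that carr by auto
  have B0: "B = B +>\<^bsub>M\<^esub> \<zero>\<^bsub>M\<^esub>"
    using B.a_subset by simp
  have add: "(B +>\<^bsub>M\<^esub> x) \<oplus>\<^bsub>Q\<^esub> (B +>\<^bsub>M\<^esub> y) = B +>\<^bsub>M\<^esub> (x \<oplus>\<^bsub>M\<^esub> y)"
    if "x \<in> carrier M" "y \<in> carrier M" for x y
    using that by (simp add: Q B.a_rcos_sum)
  have smult: "k \<odot>\<^bsub>Q\<^esub> (B +>\<^bsub>M\<^esub> x) = B +>\<^bsub>M\<^esub> (k \<odot>\<^bsub>M\<^esub> x)"
    if k: "k \<in> carrier R" and x: "x \<in> carrier M" for k x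
  proof
    show "k \<odot>\<^bsub>Q\<^esub> (B +>\<^bsub>M\<^esub> x) \<subseteq> B +>\<^bsub>M\<^esub> (k \<odot>\<^bsub>M\<^esub> x)"
    proof
      fix z assume "z \<in> k \<odot>\<^bsub>Q\<^esub> (B +>\<^bsub>M\<^esub> x)"
      then obtain b c where bc: "b \<in> B" "c \<in> B" "z = b \<oplus>\<^bsub>M\<^esub> k \<odot>\<^bsub>M\<^esub> (c \<oplus>\<^bsub>M\<^esub> x)"
        by (auto simp: Q set_add_def' a_r_coset_def')
      then have "z = (b \<oplus>\<^bsub>M\<^esub> k \<odot>\<^bsub>M\<^esub> c) \<oplus>\<^bsub>M\<^esub> k \<odot>\<^bsub>M\<^esub> x"
        using k x B.a_subset by (auto simp: smult_r_distr M.a_assoc)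
      moreover have "b \<oplus>\<^bsub>M\<^esub> k \<odot>\<^bsub>M\<^esub> c \<in> B"
        using bc k submoduleE(4,5)[OF S] by auto
      ultimately show "z \<in> B +>\<^bsub>M\<^esub> (k \<odot>\<^bsub>M\<^esub> x)"
        by (auto simp: a_r_coset_def')
    qed
    show "B +>\<^bsub>M\<^esub> (k \<odot>\<^bsub>M\<^esub> x) \<subseteq> k \<odot>\<^bsub>Q\<^esub> (B +>\<^bsub>M\<^esub> x)"
    proof
      fix z assume "z \<in> B +>\<^bsub>M\<^esub> (k \<odot>\<^bsub>M\<^esub> x)"
      then obtain b where b: "b \<in> B" "z = b \<oplus>\<^bsub>M\<^esub> k \<odot>\<^bsub>M\<^esub> x"
        by (auto simp: a_r_coset_def')
      then show "z \<in> k \<odot>\<^bsub>Q\<^esub> (B +>\<^bsub>M\<^esub> x)"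
        using B.a_rcos_self[OF x] by (auto simp: Q set_add_def')
    qed
  qed
  show "\<lbrakk>k \<in> carrier R; x \<in> carrier M\<rbrakk> \<Longrightarrow>
      k \<odot>\<^bsub>Q\<^esub> (B +>\<^bsub>M\<^esub> x) = B +>\<^bsub>M\<^esub> (k \<odot>\<^bsub>M\<^esub> x)"
    by (rule smult)
  have ab: "abelian_group Q"
  proof (rule abelian_groupI)
    fix C D E assume "C \<in> carrier Q" "D \<in> carrier Q" "E \<in> carrier Q"
    then show "(C \<oplus>\<^bsub>Q\<^esub> D) \<oplus>\<^bsub>Q\<^esub> E = C \<oplus>\<^bsub>Q\<^esub> (D \<oplus>\<^bsub>Q\<^esub> E)"
      by (auto simp: add M.a_assoc dest!: rep)
  next
    fix C D assume CD: "C \<in> carrier Q" "D \<in> carrier Q"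
    then show "C \<oplus>\<^bsub>Q\<^esub> D \<in> carrier Q" by (auto simp: add inQ dest!: rep)
    show "C \<oplus>\<^bsub>Q\<^esub> D = D \<oplus>\<^bsub>Q\<^esub> C" using CD by (auto simp: add M.a_comm dest!: rep)
  next
    show "\<zero>\<^bsub>Q\<^esub> \<in> carrier Q" using inQ[of "\<zero>\<^bsub>M\<^esub>"] B0 Q(2) by simp
  next
    fix C assume "C \<in> carrier Q"
    then obtain x where x: "x \<in> carrier M" "C = B +>\<^bsub>M\<^esub> x" using rep by auto
    have "\<zero>\<^bsub>Q\<^esub> = B +>\<^bsub>M\<^esub> \<zero>\<^bsub>M\<^esub>" using B0 Q(2) by simp
    then show "\<zero>\<^bsub>Q\<^esub> \<oplus>\<^bsub>Q\<^esub> C = C" "\<exists>D\<in>carrier Q. D \<oplus>\<^bsub>Q\<^esub> C = \<zero>\<^bsub>Q\<^esub>"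
      using x inQ[of "\<ominus>\<^bsub>M\<^esub> x"] add[of "\<zero>\<^bsub>M\<^esub>" x] add[of "\<ominus>\<^bsub>M\<^esub> x" x]
      by (auto simp: M.l_neg)
  qed
  show "module R Q"
  proof (rule moduleI)
    show "\<one> \<odot>\<^bsub>Q\<^esub> C = C" if "C \<in> carrier Q" for C
      using rep[OF that] by (auto simp: smult)
    fix k l C D assume a: "k \<in> carrier R" "l \<in> carrier R" "C \<in> carrier Q" "D \<in> carrier Q"
    obtain x y where xy: "x \<in> carrier M" "C = B +>\<^bsub>M\<^esub> x" "y \<in> carrier M" "D = B +>\<^bsub>M\<^esub> y"
      using rep a by blast
    show "k \<odot>\<^bsub>Q\<^esub> C \<in> carrier Q" using a xy by (simp add: smult inQ)
    show "(k \<oplus> l) \<odot>\<^bsub>Q\<^esub> C = k \<odot>\<^bsub>Q\<^esub> C \<oplus>\<^bsub>Q\<^esub> l \<odot>\<^bsub>Q\<^esub> C"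
      using a xy by (simp add: smult add smult_l_distr)
    show "k \<odot>\<^bsub>Q\<^esub> (C \<oplus>\<^bsub>Q\<^esub> D) = k \<odot>\<^bsub>Q\<^esub> C \<oplus>\<^bsub>Q\<^esub> k \<odot>\<^bsub>Q\<^esub> D"
      using a xy by (simp add: smult add smult_r_distr)
    show "(k \<otimes> l) \<odot>\<^bsub>Q\<^esub> C = k \<odot>\<^bsub>Q\<^esub> (l \<odot>\<^bsub>Q\<^esub> C)"
      using a xy by (simp add: smult smult_assoc1)
  qed (use ab R.cring_axioms in auto)
qed


section \<open>The differential in low degree\<close>

text \<open>Common ground for an algebra and its extension: closure properties that make the differential
  computable on short lists and zero on lists of the wrong length.\<close>

locale anchored_bracket = ring A
  for A :: "('a, 'm) ring_scheme" (structure)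
    and G :: "('a, 'g, 'o) lie_module_scheme"
    and \<rho> :: "'g \<Rightarrow> 'a \<Rightarrow> 'a" +
  assumes anchor_closed: "\<lbrakk>x \<in> carrier G; a \<in> carrier A\<rbrakk> \<Longrightarrow> \<rho> x a \<in> carrier A"
    and anchor_zero: "x \<in> carrier G \<Longrightarrow> \<rho> x \<zero> = \<zero>"
    and bracket_in: "\<lbrakk>x \<in> carrier G; y \<in> carrier G\<rbrakk> \<Longrightarrow> lie_bracket G x y \<in> carrier G"
begin

lemma differential_outside:
  "\<not> set xs \<subseteq> carrier G \<Longrightarrow> differential A G \<rho> \<beta> xs = \<zero>"
  by (simp add: differential_def)

lemma length_nths_delete: "length (nths xs (- I)) = length xs - card I"
  if "I \<subseteq> {..<length xs}"
proof -
  have "{i. i < length xs \<and> i \<in> - I} = {..<length xs} - I" by auto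
  then show ?thesis
    using that by (simp add: length_nths card_Diff_subset finite_subset)
qed

text \<open>Every summand of \<open>d\<beta>\<close> evaluates \<open>\<beta>\<close> on a list with exactly one entry less.\<close>

lemma differential_off_degree:
  assumes \<beta>: "\<And>xs. length xs \<noteq> p \<Longrightarrow> \<beta> xs = \<zero>" and xs: "length xs \<noteq> Suc p"
  shows "differential A G \<rho> \<beta> xs = \<zero>"
proof (cases "set xs \<subseteq> carrier G")
  case True
  have 1: "(\<ominus> \<one>) [^] i \<otimes> \<rho> (xs ! i) (\<beta> (nths xs (- {i}))) = \<zero>"
    if i: "i < length xs" for i
  proof -
    have "length (nths xs (- {i})) \<noteq> p"
      using i xs by (subst length_nths_delete) auto
    then show ?thesis using \<beta> i True by (simp add: anchor_zero subset_iff)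
  qed
  have 2: "(\<ominus> \<one>) [^] (i + j) \<otimes> \<beta> (lie_bracket G (xs ! i) (xs ! j) # nths xs (- {i, j})) = \<zero>"
    if ij: "i < j" "j < length xs" for i j
  proof -
    have "length (nths xs (- {i, j})) = length xs - 2"
      using ij by (subst length_nths_delete) auto
    then show ?thesis using \<beta> ij xs by simp
  qed
  have sum_zero: "finsum A f S = \<zero>" if "\<And>i. i \<in> S \<Longrightarrow> f i = \<zero>" for f :: "nat \<Rightarrow> 'a" and S
    using add.finprod_one_eqI[of S f] that by (simp add: finsum_def)
  have "(\<Oplus>i\<in>{..<length xs}. (\<ominus> \<one>) [^] i \<otimes> \<rho> (xs ! i) (\<beta> (nths xs (- {i})))) = \<zero>"
    by (rule sum_zero) (use 1 in simp)
  moreover have "(\<Oplus>j\<in>{..<length xs}. \<Oplus>i\<in>{..<j}. (\<ominus> \<one>) [^] (i + j) \<otimes>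
      \<beta> (lie_bracket G (xs ! i) (xs ! j) # nths xs (- {i, j}))) = \<zero>"
    by (intro sum_zero) (use 2 in simp)
  ultimately show ?thesis
    unfolding differential_def using True by simp
qed (rule differential_outside)

context
  fixes \<beta> :: "'g list \<Rightarrow> 'a"
  assumes \<beta>: "\<And>xs. \<beta> xs \<in> carrier A"
begin

lemma differential_singleton:
  assumes "x \<in> carrier G"
  shows "differential A G \<rho> \<beta> [x] = \<rho> x (\<beta> [])"
  using assms by (simp add: differential_def \<beta> anchor_closed lessThan_Suc)

lemma differential_pair:
  assumes "x \<in> carrier G" "y \<in> carrier G"
  shows "differential A G \<rho> \<beta> [x, y] =
    \<rho> x (\<beta> [y]) \<ominus> \<rho> y (\<beta> [x]) \<ominus> \<beta> [lie_bracket G x y]"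
  using assms
  by (simp add: differential_def \<beta> anchor_closed bracket_in lessThan_Suc nths_Cons
      l_minus a_minus_def a_ac)

lemma differential_triple:
  assumes "x \<in> carrier G" "y \<in> carrier G" "z \<in> carrier G"
  shows "differential A G \<rho> \<beta> [x, y, z] =
    (\<rho> x (\<beta> [y, z]) \<ominus> \<rho> y (\<beta> [x, z]) \<oplus> \<rho> z (\<beta> [x, y]))
    \<ominus> \<beta> [lie_bracket G x y, z] \<oplus> \<beta> [lie_bracket G x z, y] \<ominus> \<beta> [lie_bracket G y z, x]"
  using assms
  by (simp add: differential_def \<beta> anchor_closed bracket_in lessThan_Suc nths_Cons
      l_minus r_minus a_minus_def a_ac numeral_2_eq_2)

end

end


section \<open>Cochains of degree zero and one\<close>

context lrj_algebra
begin

lemma A_cring: "cring A"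
  by (rule M_cring)

lemma anchor_differential_operator:
  assumes "x \<in> carrier G"
  shows "\<rho> x \<in> linear_maps K A A"
proof -
  have "\<rho> x \<in> carrier (Diff1 K A)"
    using anchor_linear assms by (auto simp: linear_maps_def)
  then show ?thesis by (simp add: Diff1_def)
qed

lemma anchor_add:
  "\<lbrakk>x \<in> carrier G; a \<in> carrier A; b \<in> carrier A\<rbrakk> \<Longrightarrow> \<rho> x (a \<oplus>\<^bsub>A\<^esub> b) = \<rho> x a \<oplus>\<^bsub>A\<^esub> \<rho> x b"
  using anchor_differential_operator by (auto simp: linear_maps_def)

lemma anchor_smult:
  "\<lbrakk>x \<in> carrier G; k \<in> carrier K; a \<in> carrier A\<rbrakk> \<Longrightarrow> \<rho> x (k \<odot>\<^bsub>A\<^esub> a) = k \<odot>\<^bsub>A\<^esub> \<rho> x a"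
  using anchor_differential_operator by (auto simp: linear_maps_def)

lemma anchor_in: "\<lbrakk>x \<in> carrier G; a \<in> carrier A\<rbrakk> \<Longrightarrow> \<rho> x a \<in> carrier A"
  using anchor_differential_operator[of x] by (auto simp: linear_maps_def)

lemma anchor_null: "x \<in> carrier G \<Longrightarrow> \<rho> x \<zero>\<^bsub>A\<^esub> = \<zero>\<^bsub>A\<^esub>"
  using anchor_smult[of x "\<zero>\<^bsub>K\<^esub>" "\<zero>\<^bsub>A\<^esub>"] anchor_in by simp

lemma anchor_uminus:
  "\<lbrakk>x \<in> carrier G; a \<in> carrier A\<rbrakk> \<Longrightarrow> \<rho> x (\<ominus>\<^bsub>A\<^esub> a) = \<ominus>\<^bsub>A\<^esub> \<rho> x a"
  using anchor_smult[of x "\<ominus>\<^bsub>K\<^esub> \<one>\<^bsub>K\<^esub>" a] anchor_in[of x a]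
  by (simp add: smult_l_minus)

lemma anchor_left:
  assumes "x \<in> carrier G" "y \<in> carrier G" "a \<in> carrier A" "b \<in> carrier A"
  shows anchor_add_left: "\<rho> (x \<oplus>\<^bsub>G\<^esub> y) b = \<rho> x b \<oplus>\<^bsub>A\<^esub> \<rho> y b"
    and anchor_smult_left: "\<rho> (a \<odot>\<^bsub>G\<^esub> x) b = a \<otimes>\<^bsub>A\<^esub> \<rho> x b"
  using anchor_linear assms by (auto simp: linear_maps_def Diff1_def)

lemma anchor_bracket:
  "\<lbrakk>x \<in> carrier G; y \<in> carrier G; b \<in> carrier A\<rbrakk> \<Longrightarrow>
    \<rho> (lie_bracket G x y) b = \<rho> x (\<rho> y b) \<ominus>\<^bsub>A\<^esub> \<rho> y (\<rho> x b)"
  using anchor_lie_hom by (auto simp: lie_hom_def restrict_scalars_def Diff1_def commutator_def)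

lemma lie_bracket_in:
  "\<lbrakk>x \<in> carrier G; y \<in> carrier G\<rbrakk> \<Longrightarrow> lie_bracket G x y \<in> carrier G"
  using lie_algebra.bracket_closed[OF lie_algebra] by (simp add: restrict_scalars_def)

lemma anchored: "anchored_bracket A G \<rho>"
  by (intro anchored_bracket.intro anchored_bracket_axioms.intro)
    (use cring.axioms(1)[OF A_cring] anchor_in anchor_null lie_bracket_in in auto)

lemma scalar_mult:
  "\<lbrakk>k \<in> carrier K; a \<in> carrier A; b \<in> carrier A\<rbrakk> \<Longrightarrow> a \<otimes>\<^bsub>A\<^esub> (k \<odot>\<^bsub>A\<^esub> b) = k \<odot>\<^bsub>A\<^esub> (a \<otimes>\<^bsub>A\<^esub> b)"
  using smult_assoc2[of k b a] comm_monoid.m_comm[OF cring.axioms(2)[OF A_cring], of a] by simp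

lemma restrict_smult:
  "\<lbrakk>k \<in> carrier K; a \<in> carrier A\<rbrakk> \<Longrightarrow> (k \<odot>\<^bsub>A\<^esub> \<one>\<^bsub>A\<^esub>) \<otimes>\<^bsub>A\<^esub> a = k \<odot>\<^bsub>A\<^esub> a"
  using smult_assoc2[of k "\<one>\<^bsub>A\<^esub>" a] by simp

lemma cochain_in:
  assumes "\<beta> \<in> cochains A G p"
  shows "\<beta> xs \<in> carrier A"
proof (cases "xs \<in> tuples p G")
  case False
  then have "\<beta> xs = \<zero>\<^bsub>A\<^esub>" using assms by (simp add: cochains_def)
  then show ?thesis by simp
qed (use assms in \<open>simp add: cochains_def\<close>)

lemma cochain_off_degree: "\<lbrakk>\<beta> \<in> cochains A G p; length xs \<noteq> p\<rbrakk> \<Longrightarrow> \<beta> xs = \<zero>\<^bsub>A\<^esub>"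
  by (simp add: cochains_def tuples_def)

lemma cochains_0: "cochains A G 0 = const_cochain A ` carrier A"
proof (intro equalityI subsetI)
  fix \<beta> assume "\<beta> \<in> cochains A G 0"
  then have "\<beta> = const_cochain A (\<beta> [])" "\<beta> [] \<in> carrier A"
    by (auto simp: cochains_def tuples_def const_cochain_def)
  then show "\<beta> \<in> const_cochain A ` carrier A" by (rule image_eqI)
qed (auto simp: cochains_def tuples_def const_cochain_def)

lemma cochains_1:
  "\<beta> \<in> cochains A G 1 \<longleftrightarrow> (\<forall>xs. xs \<notin> (\<lambda>x. [x]) ` carrier G \<longrightarrow> \<beta> xs = \<zero>\<^bsub>A\<^esub>) \<and>
    (\<forall>x\<in>carrier G. \<beta> [x] \<in> carrier A) \<and>
    (\<forall>x\<in>carrier G. \<forall>y\<in>carrier G. \<beta> [x \<oplus>\<^bsub>G\<^esub> y] = \<beta> [x] \<oplus>\<^bsub>A\<^esub> \<beta> [y]) \<and>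
    (\<forall>a\<in>carrier A. \<forall>x\<in>carrier G. \<beta> [a \<odot>\<^bsub>G\<^esub> x] = a \<otimes>\<^bsub>A\<^esub> \<beta> [x])"
proof -
  have t: "tuples 1 G = (\<lambda>x. [x]) ` carrier G"
    by (auto simp: tuples_def length_Suc_conv)
  \<comment> \<open>The condition on linearity ranges over tuples of which one entry is then replaced; it has
    instances only because some tuple exists.\<close>
  have ne: "\<exists>x. x \<in> carrier G" using G.zero_closed by blast
  then show ?thesis
    unfolding cochains_def t by auto
qed

lemma cochain_1_eqI:
  assumes "\<beta> \<in> cochains A G 1" "\<gamma> \<in> cochains A G 1"
    and "\<And>x. x \<in> carrier G \<Longrightarrow> \<beta> [x] = \<gamma> [x]"
  shows "\<beta> = \<gamma>"
proof
  fix xs show "\<beta> xs = \<gamma> xs"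
    using assms by (cases "xs \<in> (\<lambda>x. [x]) ` carrier G") (auto simp: cochains_1 simp del: One_nat_def)
qed

lemma differential_const:
  assumes a: "a \<in> carrier A"
  shows differential_const_apply: "x \<in> carrier G \<Longrightarrow>
      differential A G \<rho> (const_cochain A a) [x] = \<rho> x a"
    and differential_const_cochain: "differential A G \<rho> (const_cochain A a) \<in> cochains A G 1"
proof -
  have c: "const_cochain A a \<in> cochains A G 0" using a by (simp add: cochains_0)
  have 1: "differential A G \<rho> (const_cochain A a) [x] = \<rho> x a" if "x \<in> carrier G" for x
    using anchored_bracket.differential_singleton[OF anchored, of "const_cochain A a" x]
      that cochain_in[OF c] by (simp add: const_cochain_def)
  then show "x \<in> carrier G \<Longrightarrow> differential A G \<rho> (const_cochain A a) [x] = \<rho> x a" by simp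
  have 2: "differential A G \<rho> (const_cochain A a) xs = \<zero>\<^bsub>A\<^esub>"
    if "xs \<notin> (\<lambda>x. [x]) ` carrier G" for xs
  proof (cases "length xs = 1")
    case True
    then obtain x where x: "xs = [x]" by (auto simp: length_Suc_conv)
    then have "x \<notin> carrier G" using that by blast
    then show ?thesis using anchored_bracket.differential_outside[OF anchored, of xs] x by simp
  next
    case False
    then show ?thesis
      using anchored_bracket.differential_off_degree[OF anchored, of 0 "const_cochain A a" xs]
        cochain_off_degree[OF c] by simp
  qed
  show "differential A G \<rho> (const_cochain A a) \<in> cochains A G 1"
    unfolding cochains_1 using a 2 by (simp add: 1 anchor_in anchor_add_left anchor_smult_left)
qed

lemma coboundaries_1:
  "coboundaries A G \<rho> 1 = (\<lambda>a. differential A G \<rho> (const_cochain A a)) ` carrier A"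
  by (auto simp: coboundaries_def cochains_0)

lemma cocycles_1:
  assumes \<beta>: "\<beta> \<in> cochains A G 1"
  shows "\<beta> \<in> cocycles A G \<rho> 1 \<longleftrightarrow> (\<forall>x\<in>carrier G. \<forall>y\<in>carrier G.
    \<rho> x (\<beta> [y]) \<ominus>\<^bsub>A\<^esub> \<rho> y (\<beta> [x]) \<ominus>\<^bsub>A\<^esub> \<beta> [lie_bracket G x y] = \<zero>\<^bsub>A\<^esub>)" (is "_ \<longleftrightarrow> ?R")
proof -
  note pair = anchored_bracket.differential_pair[OF anchored, of \<beta>, OF cochain_in[OF \<beta>]]
  have "differential A G \<rho> \<beta> xs = \<zero>\<^bsub>A\<^esub>" if R: ?R for xs
  proof (cases "length xs = 2 \<and> set xs \<subseteq> carrier G")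
    case True
    then show ?thesis using R pair by (auto simp: length_Suc_conv numeral_2_eq_2)
  next
    case False
    then show ?thesis
      using anchored_bracket.differential_outside[OF anchored, of xs \<beta>]
        anchored_bracket.differential_off_degree[OF anchored, of 1 \<beta> xs]
        cochain_off_degree[OF \<beta>] by auto
  qed
  then show ?thesis
    using \<beta> unfolding cocycles_def zero_cochain_def fun_eq_iff mem_Collect_eq by (metis pair)
qed

text \<open>This is \<open>d (d a) = 0\<close> for \<open>a \<in> A\<close>, which says that the anchor respects brackets.\<close>

lemma coboundaries_1_subset: "coboundaries A G \<rho> 1 \<subseteq> cocycles A G \<rho> 1"
proof
  fix \<beta> assume "\<beta> \<in> coboundaries A G \<rho> 1"
  then obtain a where a: "a \<in> carrier A" and \<beta>: "\<beta> = differential A G \<rho> (const_cochain A a)"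
    by (auto simp: coboundaries_1 simp del: One_nat_def)
  have c: "\<beta> \<in> cochains A G 1" using a unfolding \<beta> by (rule differential_const_cochain)
  have "\<rho> x (\<beta> [y]) \<ominus>\<^bsub>A\<^esub> \<rho> y (\<beta> [x]) \<ominus>\<^bsub>A\<^esub> \<beta> [lie_bracket G x y] = \<zero>\<^bsub>A\<^esub>"
    if xy: "x \<in> carrier G" "y \<in> carrier G" for x y
    using xy a anchor_in by (simp add: \<beta> differential_const_apply lie_bracket_in anchor_bracket
        M.minus_eq M.r_neg)
  then show "\<beta> \<in> cocycles A G \<rho> 1" using cocycles_1[OF c] by simp
qed

end

text \<open>An ambient \<open>K\<close>-space containing all cochains, so that the vector space axioms for cocycles
  reduce to closure properties.\<close>

definition function_space :: "('k, 'a, 'm) module_scheme \<Rightarrow> ('k, 'x list \<Rightarrow> 'a) module" where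
  "function_space A = \<lparr>carrier = {\<beta>. \<forall>xs. \<beta> xs \<in> carrier A}, mult = undefined, one = undefined,
    zero = zero_cochain A, add = add_cochain A, smult = (\<lambda>k \<beta> xs. k \<odot>\<^bsub>A\<^esub> \<beta> xs)\<rparr>"

lemma (in module) function_space_module: "module R (function_space M)"
proof (rule moduleI)
  show "abelian_group (function_space M)"
  proof (rule abelian_groupI)
    fix \<beta> assume b: "\<beta> \<in> carrier (function_space M)"
    show "\<exists>\<gamma>\<in>carrier (function_space M). \<gamma> \<oplus>\<^bsub>function_space M\<^esub> \<beta> = \<zero>\<^bsub>function_space M\<^esub>"
      by (rule bexI[of _ "\<lambda>xs. \<ominus>\<^bsub>M\<^esub> \<beta> xs"])
        (use b in \<open>auto simp: function_space_def add_cochain_def zero_cochain_def M.l_neg\<close>)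
  qed (auto simp: function_space_def add_cochain_def zero_cochain_def M.a_ac)
qed (use R.cring_axioms in \<open>auto simp: function_space_def add_cochain_def smult_l_distr
    smult_r_distr smult_assoc1\<close>)


context lrj_algebra
begin

lemma cocycles_1_submodule: "submodule (cocycles A G \<rho> 1) K (function_space A)"
proof (rule module.submodule_criterion[OF function_space_module])
  show "cocycles A G \<rho> 1 \<subseteq> carrier (function_space A)"
    by (auto simp: cocycles_def function_space_def cochain_in)
  have *: "\<beta> \<in> cocycles A G \<rho> 1 \<longleftrightarrow> \<beta> \<in> cochains A G 1 \<and> (\<forall>x\<in>carrier G. \<forall>y\<in>carrier G.
    \<rho> x (\<beta> [y]) \<ominus>\<^bsub>A\<^esub> \<rho> y (\<beta> [x]) \<ominus>\<^bsub>A\<^esub> \<beta> [lie_bracket G x y] = \<zero>\<^bsub>A\<^esub>)" for \<beta>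
    using cocycles_1[of \<beta>] by (auto simp: cocycles_def simp del: One_nat_def)
  show "\<zero>\<^bsub>function_space A\<^esub> \<in> cocycles A G \<rho> 1"
    unfolding * cochains_1
    by (simp add: function_space_def zero_cochain_def anchor_null M.minus_eq)
  fix \<beta> assume \<beta>: "\<beta> \<in> cocycles A G \<rho> 1"
  then have bA: "\<beta> xs \<in> carrier A" for xs by (auto simp: cocycles_def cochain_in)
  { fix \<gamma> assume \<gamma>: "\<gamma> \<in> cocycles A G \<rho> 1"
    then have cA: "\<gamma> xs \<in> carrier A" for xs by (auto simp: cocycles_def cochain_in)
    have "\<rho> x (\<beta> [y] \<oplus>\<^bsub>A\<^esub> \<gamma> [y]) \<ominus>\<^bsub>A\<^esub> \<rho> y (\<beta> [x] \<oplus>\<^bsub>A\<^esub> \<gamma> [x])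
        \<ominus>\<^bsub>A\<^esub> (\<beta> [lie_bracket G x y] \<oplus>\<^bsub>A\<^esub> \<gamma> [lie_bracket G x y]) = \<zero>\<^bsub>A\<^esub>"
      if xy: "x \<in> carrier G" "y \<in> carrier G" for x y
    proof -
      have "\<rho> x (\<beta> [y] \<oplus>\<^bsub>A\<^esub> \<gamma> [y]) \<ominus>\<^bsub>A\<^esub> \<rho> y (\<beta> [x] \<oplus>\<^bsub>A\<^esub> \<gamma> [x])
          \<ominus>\<^bsub>A\<^esub> (\<beta> [lie_bracket G x y] \<oplus>\<^bsub>A\<^esub> \<gamma> [lie_bracket G x y]) =
        (\<rho> x (\<beta> [y]) \<ominus>\<^bsub>A\<^esub> \<rho> y (\<beta> [x]) \<ominus>\<^bsub>A\<^esub> \<beta> [lie_bracket G x y]) \<oplus>\<^bsub>A\<^esub>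
        (\<rho> x (\<gamma> [y]) \<ominus>\<^bsub>A\<^esub> \<rho> y (\<gamma> [x]) \<ominus>\<^bsub>A\<^esub> \<gamma> [lie_bracket G x y])"
        using xy bA cA anchor_in
        by (simp add: anchor_add M.minus_eq M.minus_add M.a_ac)
      also have "\<dots> = \<zero>\<^bsub>A\<^esub>" using \<beta> \<gamma> xy unfolding * by simp
      finally show ?thesis .
    qed
    then show "\<beta> \<oplus>\<^bsub>function_space A\<^esub> \<gamma> \<in> cocycles A G \<rho> 1"
      using \<beta> \<gamma> unfolding * cochains_1
      by (simp add: function_space_def add_cochain_def M.a_ac cring.cring_simprules[OF A_cring]) }
  { fix k assume k: "k \<in> carrier K"
    have "\<rho> x (k \<odot>\<^bsub>A\<^esub> \<beta> [y]) \<ominus>\<^bsub>A\<^esub> \<rho> y (k \<odot>\<^bsub>A\<^esub> \<beta> [x])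
        \<ominus>\<^bsub>A\<^esub> k \<odot>\<^bsub>A\<^esub> \<beta> [lie_bracket G x y] = \<zero>\<^bsub>A\<^esub>"
      if xy: "x \<in> carrier G" "y \<in> carrier G" for x y
    proof -
      have "\<rho> x (k \<odot>\<^bsub>A\<^esub> \<beta> [y]) \<ominus>\<^bsub>A\<^esub> \<rho> y (k \<odot>\<^bsub>A\<^esub> \<beta> [x])
          \<ominus>\<^bsub>A\<^esub> k \<odot>\<^bsub>A\<^esub> \<beta> [lie_bracket G x y] =
        k \<odot>\<^bsub>A\<^esub> (\<rho> x (\<beta> [y]) \<ominus>\<^bsub>A\<^esub> \<rho> y (\<beta> [x]) \<ominus>\<^bsub>A\<^esub> \<beta> [lie_bracket G x y])"
        using xy k bA anchor_in
        by (simp add: anchor_smult M.minus_eq smult_r_distr smult_r_minus)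
      also have "\<dots> = \<zero>\<^bsub>A\<^esub>" using \<beta> k xy unfolding * by simp
      finally show ?thesis .
    qed
    then show "k \<odot>\<^bsub>function_space A\<^esub> \<beta> \<in> cocycles A G \<rho> 1"
      using \<beta> k bA unfolding * cochains_1
      by (simp add: function_space_def smult_r_distr scalar_mult) }
qed

lemma cocycle_space_module: "module K (cocycle_space A G \<rho> 1)"
proof -
  have "cocycle_space A G \<rho> 1 = (function_space A)\<lparr>carrier := cocycles A G \<rho> 1\<rparr>"
    by (simp add: cocycle_space_def function_space_def)
  then show ?thesis
    using submodule.submodule_is_module[OF cocycles_1_submodule function_space_module] by simp
qed

lemma coboundaries_1_submodule:
  "submodule (coboundaries A G \<rho> 1) K (cocycle_space A G \<rho> 1)" (is "submodule ?B K ?Z")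
proof (rule module.submodule_criterion[OF cocycle_space_module])
  let ?d = "\<lambda>a. differential A G \<rho> (const_cochain A a)"
  show BZ: "?B \<subseteq> carrier ?Z"
    using coboundaries_1_subset by (simp add: cocycle_space_def)
  have eqI: "\<beta> \<in> ?B" if "\<beta> \<in> carrier ?Z" "a \<in> carrier A" "\<And>x. x \<in> carrier G \<Longrightarrow> \<beta> [x] = \<rho> x a" for \<beta> a
  proof -
    have "\<beta> = ?d a"
      by (rule cochain_1_eqI) (use that differential_const in
        \<open>auto simp: cocycle_space_def cocycles_def simp del: One_nat_def\<close>)
    then show ?thesis using that by (simp only: coboundaries_1) blast
  qed
  interpret Z: module K ?Z by (rule cocycle_space_module)
  show "\<zero>\<^bsub>?Z\<^esub> \<in> ?B"
    by (rule eqI[of _ "\<zero>\<^bsub>A\<^esub>"]) (use Z.zero_closed in \<open>auto simp: anchor_null cocycle_space_def zero_cochain_def\<close>)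
  fix \<beta> assume b: "\<beta> \<in> ?B"
  then obtain a where a: "a \<in> carrier A" "\<beta> = ?d a" unfolding coboundaries_1 by auto
  { fix \<gamma> assume c: "\<gamma> \<in> ?B"
    then obtain a' where a': "a' \<in> carrier A" "\<gamma> = ?d a'" unfolding coboundaries_1 by auto
    have "\<beta> \<oplus>\<^bsub>?Z\<^esub> \<gamma> \<in> carrier ?Z" using b c BZ by blast
    then show "\<beta> \<oplus>\<^bsub>?Z\<^esub> \<gamma> \<in> ?B"
      by (rule eqI[of _ "a \<oplus>\<^bsub>A\<^esub> a'"])
        (use a a' in \<open>auto simp: cocycle_space_def add_cochain_def differential_const_apply anchor_add\<close>) }
  { fix k assume k: "k \<in> carrier K"
    then have "k \<odot>\<^bsub>?Z\<^esub> \<beta> \<in> carrier ?Z" using b BZ by blast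
    then show "k \<odot>\<^bsub>?Z\<^esub> \<beta> \<in> ?B"
      by (rule eqI[of _ "k \<odot>\<^bsub>A\<^esub> a"])
        (use a k in \<open>auto simp: cocycle_space_def differential_const_apply anchor_smult\<close>) }
qed

lemma cohomology_1_fields:
  "carrier (cohomology A G \<rho> 1) = a_rcosets\<^bsub>cocycle_space A G \<rho> 1\<^esub> (coboundaries A G \<rho> 1)"
  "\<zero>\<^bsub>cohomology A G \<rho> 1\<^esub> = coboundaries A G \<rho> 1"
  "add (cohomology A G \<rho> 1) = set_add (cocycle_space A G \<rho> 1)"
  "k \<odot>\<^bsub>cohomology A G \<rho> 1\<^esub> C = coboundaries A G \<rho> 1 <+>\<^bsub>cocycle_space A G \<rho> 1\<^esub>
    ((\<lambda>\<beta>. k \<odot>\<^bsub>cocycle_space A G \<rho> 1\<^esub> \<beta>) ` C)"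
  "lie_bracket (cohomology A G \<rho> 1) C D = coboundaries A G \<rho> 1"
  by (simp_all add: cohomology_def Let_def)

lemmas cohomology_1_module =
  module.quotient_module_axioms[OF cocycle_space_module coboundaries_1_submodule cohomology_1_fields(1-4)]

lemmas cohomology_1_smult =
  module.quotient_smult[OF cocycle_space_module coboundaries_1_submodule cohomology_1_fields(1-4)]

lemma cohomology_1_lie: "lie_algebra K (cohomology A G \<rho> 1)"
proof -
  interpret Q: module K "cohomology A G \<rho> 1" by (rule cohomology_1_module)
  have br: "lie_bracket (cohomology A G \<rho> 1) C D = \<zero>\<^bsub>cohomology A G \<rho> 1\<^esub>" for C D
    by (simp only: cohomology_1_fields)
  show ?thesis
    by (intro lie_algebra.intro cohomology_1_module field_axioms lie_algebra_axioms.intro)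
      (simp_all only: br Q.zero_closed Q.l_zero Q.smult_r_null)
qed

lemma coboundaries_1_subgroup: "abelian_subgroup (coboundaries A G \<rho> 1) (cocycle_space A G \<rho> 1)"
  by (rule abelian_subgroupI3)
    (use module.axioms(2)[OF cocycle_space_module] submodule.axioms(1)[OF coboundaries_1_submodule]
      in \<open>auto simp: additive_subgroup_def\<close>)

lemma cohomology_class_zero_iff:
  assumes "\<beta> \<in> cocycles A G \<rho> 1"
  shows "cohomology_class A G \<rho> 1 \<beta> = coboundaries A G \<rho> 1 \<longleftrightarrow> \<beta> \<in> coboundaries A G \<rho> 1"
proof -
  interpret B: abelian_subgroup "coboundaries A G \<rho> 1" "cocycle_space A G \<rho> 1"
    by (rule coboundaries_1_subgroup)
  have "\<beta> \<in> carrier (cocycle_space A G \<rho> 1)" using assms by (simp add: cocycle_space_def)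
  then show ?thesis
    using B.a_rcos_self[of \<beta>] B.a_rcos_const[of \<beta>] by (auto simp: cohomology_class_def)
qed

end


section \<open>Hamiltonian elements\<close>

text \<open>The cancellation behind \<open>bracket_hamiltonian\<close>, where \<open>e0\<close> is the closedness of \<open>\<omega>\<close> on
  \<open>(x, y, z)\<close>, \<open>e1\<close> that of \<open>i\<^sub>x\<omega>\<close> on \<open>(y, z)\<close>, and \<open>e2\<close> that of \<open>i\<^sub>y\<omega>\<close> on \<open>(x, z)\<close>.\<close>

lemma (in cring) six_term_cancel:
  assumes c: "p \<in> carrier R" "q \<in> carrier R" "r \<in> carrier R" "s \<in> carrier R" "t \<in> carrier R"
      "u \<in> carrier R"
    and e0: "(p \<ominus> q \<oplus> r) \<ominus> s \<oplus> t \<ominus> u = \<zero>"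
    and e1: "q \<ominus> r \<oplus> u = \<zero>" and e2: "p \<oplus> r \<oplus> t = \<zero>"
  shows "s = \<ominus> r"
proof -
  have "s \<oplus> r = (p \<oplus> r \<oplus> t) \<ominus> (q \<ominus> r \<oplus> u) \<ominus> ((p \<ominus> q \<oplus> r) \<ominus> s \<oplus> t \<ominus> u)"
    using c by algebra
  also have "\<dots> = \<zero>"
    unfolding e0 e1 e2 by (simp add: minus_eq)
  finally show ?thesis using c by (metis minus_equality)
qed

context symplectic_lrj_algebra
begin

lemma omega_in: "\<omega> xs \<in> carrier A"
  by (rule cochain_in[OF omega_cochain])

lemma omega_add:
  assumes "x \<in> carrier G" "y \<in> carrier G" "z \<in> carrier G"
  shows omega_add_left: "\<omega> [x \<oplus>\<^bsub>G\<^esub> y, z] = \<omega> [x, z] \<oplus>\<^bsub>A\<^esub> \<omega> [y, z]"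
    and omega_add_right: "\<omega> [z, x \<oplus>\<^bsub>G\<^esub> y] = \<omega> [z, x] \<oplus>\<^bsub>A\<^esub> \<omega> [z, y]"
proof -
  have "[z, z] \<in> tuples 2 G" using assms by (simp add: tuples_def)
  then have "\<omega> ([z, z][i := x \<oplus>\<^bsub>G\<^esub> y]) = \<omega> ([z, z][i := x]) \<oplus>\<^bsub>A\<^esub> \<omega> ([z, z][i := y])" if "i < 2" for i
    using omega_cochain that assms unfolding cochains_def by blast
  from this[of 0] this[of 1]
  show "\<omega> [x \<oplus>\<^bsub>G\<^esub> y, z] = \<omega> [x, z] \<oplus>\<^bsub>A\<^esub> \<omega> [y, z]"
    "\<omega> [z, x \<oplus>\<^bsub>G\<^esub> y] = \<omega> [z, x] \<oplus>\<^bsub>A\<^esub> \<omega> [z, y]"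
    by simp_all
qed

lemma omega_smult:
  assumes "x \<in> carrier G" "z \<in> carrier G" "a \<in> carrier A"
  shows omega_smult_left: "\<omega> [a \<odot>\<^bsub>G\<^esub> x, z] = a \<otimes>\<^bsub>A\<^esub> \<omega> [x, z]"
    and omega_smult_right: "\<omega> [z, a \<odot>\<^bsub>G\<^esub> x] = a \<otimes>\<^bsub>A\<^esub> \<omega> [z, x]"
proof -
  have "[z, z] \<in> tuples 2 G" using assms by (simp add: tuples_def)
  then have "\<omega> ([z, z][i := a \<odot>\<^bsub>G\<^esub> x]) = a \<otimes>\<^bsub>A\<^esub> \<omega> ([z, z][i := x])" if "i < 2" for i
    using omega_cochain that assms unfolding cochains_def by blast
  from this[of 0] this[of 1]
  show "\<omega> [a \<odot>\<^bsub>G\<^esub> x, z] = a \<otimes>\<^bsub>A\<^esub> \<omega> [x, z]" "\<omega> [z, a \<odot>\<^bsub>G\<^esub> x] = a \<otimes>\<^bsub>A\<^esub> \<omega> [z, x]"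
    by simp_all
qed

lemma omega_self: "x \<in> carrier G \<Longrightarrow> \<omega> [x, x] = \<zero>\<^bsub>A\<^esub>"
proof -
  assume "x \<in> carrier G"
  then have "[x, x] \<in> tuples 2 G" by (simp add: tuples_def)
  moreover have "0 < (1::nat) \<and> 1 < (2::nat) \<and> [x, x] ! 0 = [x, x] ! 1" by simp
  ultimately show ?thesis using omega_cochain unfolding cochains_def by blast
qed

text \<open>Expand \<open>\<omega>(x + y, x + y) = 0\<close>.\<close>

lemma omega_swap:
  assumes "x \<in> carrier G" "y \<in> carrier G"
  shows "\<omega> [y, x] = \<ominus>\<^bsub>A\<^esub> \<omega> [x, y]"
proof -
  have "\<zero>\<^bsub>A\<^esub> = \<omega> [x \<oplus>\<^bsub>G\<^esub> y, x \<oplus>\<^bsub>G\<^esub> y]" using assms by (simp add: omega_self)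
  also have "\<dots> = \<omega> [y, x] \<oplus>\<^bsub>A\<^esub> \<omega> [x, y]"
    using assms by (simp add: omega_add omega_self[of x] omega_self[of y] omega_in)
  finally show ?thesis using M.minus_equality omega_in by metis
qed

lemma interior_cochain: "x \<in> carrier G \<Longrightarrow> interior x \<omega> \<in> cochains A G 1"
proof -
  assume x: "x \<in> carrier G"
  have "\<omega> (x # xs) = \<zero>\<^bsub>A\<^esub>" if "xs \<notin> (\<lambda>x. [x]) ` carrier G" for xs
  proof -
    have "x # xs \<notin> tuples 2 G" using that by (auto simp: tuples_def length_Suc_conv)
    then show ?thesis using omega_cochain unfolding cochains_def by blast
  qed
  then show ?thesis
    unfolding cochains_1 interior_def
    using x omega_add_right omega_smult_right omega_in by auto
qed

text \<open>The bijection of \<open>G\<close> with its dual, transported to one-cochains: a one-cochain is determined by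
  its values on singleton lists, and these form a linear functional.\<close>

lemma omega_nondegenerate:
  assumes \<beta>: "\<beta> \<in> cochains A G 1"
  shows "\<exists>!x. x \<in> carrier G \<and> interior x \<omega> = \<beta>"
proof -
  have "(\<lambda>y\<in>carrier G. \<beta> [y]) \<in> carrier (dual_module A G)"
    using \<beta>[unfolded cochains_1] by (auto simp: dual_module_def linear_maps_def self_module_def)
  then obtain x where x: "x \<in> carrier G" "flat G \<omega> x = (\<lambda>y\<in>carrier G. \<beta> [y])"
    using flat_bij unfolding bij_betw_def by (metis (no_types, lifting) imageE)
  have "interior x \<omega> = \<beta>"
  proof (rule cochain_1_eqI[OF interior_cochain[OF x(1)] \<beta>])
    fix y assume "y \<in> carrier G"
    then show "interior x \<omega> [y] = \<beta> [y]" using fun_cong[OF x(2), of y] by (simp add: flat_def)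
  qed
  moreover have "x = y" if "x \<in> carrier G" "y \<in> carrier G" "interior x \<omega> = interior y \<omega>" for x y
  proof -
    have "flat G \<omega> x = flat G \<omega> y" using that(3) by (simp add: flat_def)
    then show ?thesis using flat_bij that(1,2) unfolding bij_betw_def by (auto dest: inj_onD)
  qed
  ultimately show ?thesis using x(1) by blast
qed

text \<open>In \<open>L\<^sub>x\<omega> = i\<^sub>x d\<omega> + d i\<^sub>x\<omega>\<close> the first summand vanishes.\<close>

lemma loc_hamiltonian_iff:
  "x \<in> loc_hamiltonian A G \<rho> \<omega> \<longleftrightarrow> x \<in> carrier G \<and> interior x \<omega> \<in> cocycles A G \<rho> 1"
proof (cases "x \<in> carrier G")
  case True
  \<comment> \<open>Dropping the zero summand requires the other one to lie in the carrier.\<close>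
  have c: "differential A G \<rho> (interior x \<omega>) xs \<in> carrier A" for xs
  proof (cases "length xs = 2 \<and> set xs \<subseteq> carrier G")
    case len: True
    then obtain y z where yz: "xs = [y, z]" "y \<in> carrier G" "z \<in> carrier G"
      by (auto simp: length_Suc_conv numeral_2_eq_2)
    then show ?thesis
      using anchored_bracket.differential_pair[OF anchored, of "interior x \<omega>" y z]
        cochain_in[OF interior_cochain[OF True]] anchor_in lie_bracket_in by simp
  next
    case False
    then show ?thesis
      using anchored_bracket.differential_outside[OF anchored, of xs "interior x \<omega>"]
        anchored_bracket.differential_off_degree[OF anchored, of 1 "interior x \<omega>" xs]
        cochain_off_degree[OF interior_cochain[OF True]]
      by (cases "set xs \<subseteq> carrier G") simp_all
  qed
  have "interior x (zero_cochain A) = zero_cochain A"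
    by (simp add: interior_def zero_cochain_def)
  then have "lie_derivative A G \<rho> x \<omega> = differential A G \<rho> (interior x \<omega>)"
    using c by (simp add: lie_derivative_def omega_closed add_cochain_def fun_eq_iff)
      (simp add: zero_cochain_def)
  then show ?thesis
    using True interior_cochain[OF True] by (simp add: loc_hamiltonian_def cocycles_def)
qed (simp add: loc_hamiltonian_def)

text \<open>By nondegeneracy, the description defining the symplectic gradient always denotes.\<close>

lemma hamiltonian_iff:
  "x \<in> hamiltonian A G \<rho> \<omega> \<longleftrightarrow> x \<in> carrier G \<and> interior x \<omega> \<in> coboundaries A G \<rho> 1"
proof -
  have g: "symplectic_gradient A G \<rho> \<omega> a \<in> carrier G \<and>
      interior (symplectic_gradient A G \<rho> \<omega> a) \<omega> = differential A G \<rho> (const_cochain A a)"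
    if "a \<in> carrier A" for a
    unfolding symplectic_gradient_def
    by (rule theI') (rule omega_nondegenerate[OF differential_const_cochain[OF that]])
  have u: "symplectic_gradient A G \<rho> \<omega> a = x"
    if "x \<in> carrier G" "a \<in> carrier A" "interior x \<omega> = differential A G \<rho> (const_cochain A a)" for a
    using g[OF that(2)] that omega_nondegenerate[OF differential_const_cochain[OF that(2)]] by blast
  show ?thesis
    unfolding hamiltonian_def coboundaries_1 using g u by blast
qed

lemma hamiltonian_subset: "hamiltonian A G \<rho> \<omega> \<subseteq> loc_hamiltonian A G \<rho> \<omega>"
  using coboundaries_1_subset by (auto simp: hamiltonian_iff loc_hamiltonian_iff simp del: One_nat_def)

text \<open>\<open>[x, y]\<close> is the symplectic gradient of \<open>- \<omega>(x, y)\<close>: on \<open>(x, y, z)\<close>, closedness of \<open>\<omega>\<close> together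
  with that of \<open>i\<^sub>x\<omega>\<close> and \<open>i\<^sub>y\<omega>\<close> leaves only the terms \<open>\<omega>([x, y], z)\<close> and \<open>\<rho>(z)(\<omega>(x, y))\<close>.\<close>

lemma bracket_hamiltonian:
  assumes "x \<in> loc_hamiltonian A G \<rho> \<omega>" "y \<in> loc_hamiltonian A G \<rho> \<omega>"
  shows "lie_bracket G x y \<in> hamiltonian A G \<rho> \<omega>"
proof -
  have xy: "x \<in> carrier G" "y \<in> carrier G" using assms by (auto simp: loc_hamiltonian_iff)
  note br = lie_bracket_in
  have "\<omega> [lie_bracket G x y, z] = \<rho> z (\<ominus>\<^bsub>A\<^esub> \<omega> [x, y])" if z: "z \<in> carrier G" for z
  proof -
    have 0: "(\<rho> x (\<omega> [y, z]) \<ominus>\<^bsub>A\<^esub> \<rho> y (\<omega> [x, z]) \<oplus>\<^bsub>A\<^esub> \<rho> z (\<omega> [x, y]))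
      \<ominus>\<^bsub>A\<^esub> \<omega> [lie_bracket G x y, z] \<oplus>\<^bsub>A\<^esub> \<omega> [lie_bracket G x z, y] \<ominus>\<^bsub>A\<^esub> \<omega> [lie_bracket G y z, x] = \<zero>\<^bsub>A\<^esub>"
      using anchored_bracket.differential_triple[OF anchored, of \<omega>, OF omega_in xy z] omega_closed
      by (simp add: zero_cochain_def)
    have 1: "\<rho> y (\<omega> [x, z]) \<ominus>\<^bsub>A\<^esub> \<rho> z (\<omega> [x, y]) \<ominus>\<^bsub>A\<^esub> \<omega> [x, lie_bracket G y z] = \<zero>\<^bsub>A\<^esub>"
      using assms(1) xy z cocycles_1[OF interior_cochain[OF xy(1)]]
      by (simp add: loc_hamiltonian_iff interior_def del: One_nat_def)
    have 2: "\<rho> x (\<omega> [y, z]) \<ominus>\<^bsub>A\<^esub> \<rho> z (\<omega> [y, x]) \<ominus>\<^bsub>A\<^esub> \<omega> [y, lie_bracket G x z] = \<zero>\<^bsub>A\<^esub>"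
      using assms(2) xy z cocycles_1[OF interior_cochain[OF xy(2)]]
      by (simp add: loc_hamiltonian_iff interior_def del: One_nat_def)
    define p q r s t u where "p = \<rho> x (\<omega> [y, z])" and "q = \<rho> y (\<omega> [x, z])" and "r = \<rho> z (\<omega> [x, y])"
      and "s = \<omega> [lie_bracket G x y, z]" and "t = \<omega> [lie_bracket G x z, y]"
      and "u = \<omega> [lie_bracket G y z, x]"
    have c: "p \<in> carrier A" "q \<in> carrier A" "r \<in> carrier A" "s \<in> carrier A" "t \<in> carrier A" "u \<in> carrier A"
      using xy z omega_in anchor_in by (auto simp: p_def q_def r_def s_def t_def u_def)
    have sw: "\<rho> z (\<omega> [y, x]) = \<ominus>\<^bsub>A\<^esub> r" "\<omega> [x, lie_bracket G y z] = \<ominus>\<^bsub>A\<^esub> u"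
      "\<omega> [y, lie_bracket G x z] = \<ominus>\<^bsub>A\<^esub> t"
      using xy z br omega_in
      by (auto simp: r_def u_def t_def anchor_uminus omega_swap[of x y]
          omega_swap[of "lie_bracket G y z" x] omega_swap[of "lie_bracket G x z" y])
    have e0: "(p \<ominus>\<^bsub>A\<^esub> q \<oplus>\<^bsub>A\<^esub> r) \<ominus>\<^bsub>A\<^esub> s \<oplus>\<^bsub>A\<^esub> t \<ominus>\<^bsub>A\<^esub> u = \<zero>\<^bsub>A\<^esub>"
      using 0 by (simp add: p_def q_def r_def s_def t_def u_def)
    have e1: "q \<ominus>\<^bsub>A\<^esub> r \<oplus>\<^bsub>A\<^esub> u = \<zero>\<^bsub>A\<^esub>"
      using 1 sw c by (simp add: M.minus_eq flip: q_def r_def)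
    have e2: "p \<oplus>\<^bsub>A\<^esub> r \<oplus>\<^bsub>A\<^esub> t = \<zero>\<^bsub>A\<^esub>"
      using 2 sw c by (simp add: M.minus_eq flip: p_def)
    have "s = \<ominus>\<^bsub>A\<^esub> r" by (rule cring.six_term_cancel[OF A_cring c e0 e1 e2])
    then show ?thesis using z omega_in by (simp add: s_def r_def anchor_uminus)
  qed
  then have "interior (lie_bracket G x y) \<omega> = differential A G \<rho> (const_cochain A (\<ominus>\<^bsub>A\<^esub> \<omega> [x, y]))"
    using xy omega_in
    by (intro cochain_1_eqI interior_cochain br differential_const_cochain)
      (auto simp: differential_const_apply interior_def)
  then show ?thesis
    using xy br omega_in unfolding hamiltonian_iff coboundaries_1 by blast
qed

lemma interior_add:
  "\<lbrakk>x \<in> carrier G; y \<in> carrier G\<rbrakk> \<Longrightarrow>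
    interior (x \<oplus>\<^bsub>G\<^esub> y) \<omega> = interior x \<omega> \<oplus>\<^bsub>cocycle_space A G \<rho> 1\<^esub> interior y \<omega>"
proof
  fix xs assume xy: "x \<in> carrier G" "y \<in> carrier G"
  have 0: "interior z \<omega> xs = \<zero>\<^bsub>A\<^esub>" if "xs \<notin> (\<lambda>x. [x]) ` carrier G" "z \<in> carrier G" for z
    using interior_cochain[OF that(2)] that(1) unfolding cochains_1 by blast
  show "interior (x \<oplus>\<^bsub>G\<^esub> y) \<omega> xs = (interior x \<omega> \<oplus>\<^bsub>cocycle_space A G \<rho> 1\<^esub> interior y \<omega>) xs"
    using xy 0 by (cases "xs \<in> (\<lambda>x. [x]) ` carrier G")
      (auto simp: cocycle_space_def add_cochain_def interior_def omega_add_left)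
qed

lemma interior_smult:
  "\<lbrakk>k \<in> carrier K; x \<in> carrier G\<rbrakk> \<Longrightarrow>
    interior ((k \<odot>\<^bsub>A\<^esub> \<one>\<^bsub>A\<^esub>) \<odot>\<^bsub>G\<^esub> x) \<omega> = k \<odot>\<^bsub>cocycle_space A G \<rho> 1\<^esub> interior x \<omega>"
proof
  fix xs assume kx: "k \<in> carrier K" "x \<in> carrier G"
  have k: "k \<odot>\<^bsub>A\<^esub> \<one>\<^bsub>A\<^esub> \<in> carrier A" using kx by simp
  have 0: "interior z \<omega> xs = \<zero>\<^bsub>A\<^esub>" if "xs \<notin> (\<lambda>x. [x]) ` carrier G" "z \<in> carrier G" for z
    using interior_cochain[OF that(2)] that(1) unfolding cochains_1 by blast
  show "interior ((k \<odot>\<^bsub>A\<^esub> \<one>\<^bsub>A\<^esub>) \<odot>\<^bsub>G\<^esub> x) \<omega> xs = (k \<odot>\<^bsub>cocycle_space A G \<rho> 1\<^esub> interior x \<omega>) xs"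
    using kx k 0 by (cases "xs \<in> (\<lambda>x. [x]) ` carrier G")
      (auto simp: cocycle_space_def interior_def omega_smult_left restrict_smult omega_in)
qed

lemma interior_zero: "interior \<zero>\<^bsub>G\<^esub> \<omega> = \<zero>\<^bsub>cocycle_space A G \<rho> 1\<^esub>"
proof -
  have "module.smult (cocycle_space A G \<rho> 1) \<zero>\<^bsub>K\<^esub> (interior \<zero>\<^bsub>G\<^esub> \<omega>) = zero_cochain A"
    using omega_in by (simp add: cocycle_space_def zero_cochain_def interior_def)
  moreover have "(\<zero>\<^bsub>K\<^esub> \<odot>\<^bsub>A\<^esub> \<one>\<^bsub>A\<^esub>) \<odot>\<^bsub>G\<^esub> \<zero>\<^bsub>G\<^esub> = \<zero>\<^bsub>G\<^esub>"
    by simp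
  ultimately show ?thesis
    using interior_smult[of "\<zero>\<^bsub>K\<^esub>" "\<zero>\<^bsub>G\<^esub>"] by (simp add: cocycle_space_def)
qed

text \<open>Taken for \<open>S\<close> all cocycles or all coboundaries, this treats locally Hamiltonian and Hamiltonian
  elements at once.\<close>

lemma interior_preimage_submodule:
  assumes S: "submodule S K (cocycle_space A G \<rho> 1)"
  shows "submodule {x \<in> carrier G. interior x \<omega> \<in> S} K (restrict_scalars A G)"
proof -
  note S' = module.submoduleE(4,5)[OF cocycle_space_module S]
    subgroup.one_closed[OF submodule.axioms(1)[OF S]]
  have k: "k \<odot>\<^bsub>A\<^esub> \<one>\<^bsub>A\<^esub> \<in> carrier A" if "k \<in> carrier K" for k
    using that by simp
  have m: "module K (restrict_scalars A G)"
    using lie_algebra by (simp add: lie_algebra_def)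
  show ?thesis
    by (rule module.submodule_criterion[OF m])
      (use S' k in \<open>auto simp: restrict_scalars_def interior_zero interior_add interior_smult
        simp del: One_nat_def\<close>)
qed

lemma loc_hamiltonian_submodule: "submodule (loc_hamiltonian A G \<rho> \<omega>) K (restrict_scalars A G)"
proof -
  have "loc_hamiltonian A G \<rho> \<omega> = {x \<in> carrier G. interior x \<omega> \<in> carrier (cocycle_space A G \<rho> 1)}"
    using loc_hamiltonian_iff by (auto simp: cocycle_space_def)
  then show ?thesis
    using interior_preimage_submodule[OF module.carrier_is_submodule[OF cocycle_space_module]]
    by (simp only:)
qed

lemma hamiltonian_submodule: "submodule (hamiltonian A G \<rho> \<omega>) K (restrict_scalars A G)"
proof -
  have "hamiltonian A G \<rho> \<omega> = {x \<in> carrier G. interior x \<omega> \<in> coboundaries A G \<rho> 1}"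
    using hamiltonian_iff by auto
  then show ?thesis
    using interior_preimage_submodule[OF coboundaries_1_submodule] by (simp only:)
qed

lemma loc_hamiltonian_lie: "lie_algebra K (ham_loc_lie A G \<rho> \<omega>)"
  unfolding ham_loc_lie_def
proof (rule lie_algebra.lie_subalgebra[OF lie_algebra loc_hamiltonian_submodule])
  fix x y assume "x \<in> loc_hamiltonian A G \<rho> \<omega>" "y \<in> loc_hamiltonian A G \<rho> \<omega>"
  then show "lie_bracket (restrict_scalars A G) x y \<in> loc_hamiltonian A G \<rho> \<omega>"
    using bracket_hamiltonian hamiltonian_subset by (auto simp: restrict_scalars_def)
qed

lemma hamiltonian_lie: "lie_algebra K (ham_lie A G \<rho> \<omega>)"
  unfolding ham_lie_def
proof (rule lie_algebra.lie_subalgebra[OF lie_algebra hamiltonian_submodule])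
  fix x y assume "x \<in> hamiltonian A G \<rho> \<omega>" "y \<in> hamiltonian A G \<rho> \<omega>"
  then show "lie_bracket (restrict_scalars A G) x y \<in> hamiltonian A G \<rho> \<omega>"
    using bracket_hamiltonian hamiltonian_subset by (auto simp: restrict_scalars_def)
qed


section \<open>The obstruction map\<close>

lemma Obs_zero_iff:
  assumes "x \<in> loc_hamiltonian A G \<rho> \<omega>"
  shows "Obs A G \<rho> \<omega> x = coboundaries A G \<rho> 1 \<longleftrightarrow> x \<in> hamiltonian A G \<rho> \<omega>"
proof -
  have "interior x \<omega> \<in> cocycles A G \<rho> 1" "x \<in> carrier G"
    using assms by (auto simp: loc_hamiltonian_iff)
  then show ?thesis
    using cohomology_class_zero_iff by (simp add: Obs_def hamiltonian_iff del: One_nat_def)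
qed

text \<open>Nondegeneracy realises every cocycle as \<open>i\<^sub>x\<omega>\<close>.\<close>

lemma Obs_image: "Obs A G \<rho> \<omega> ` loc_hamiltonian A G \<rho> \<omega> = carrier (cohomology A G \<rho> 1)"
proof -
  have "(\<lambda>x. interior x \<omega>) ` loc_hamiltonian A G \<rho> \<omega> = cocycles A G \<rho> 1"
  proof
    show "cocycles A G \<rho> 1 \<subseteq> (\<lambda>x. interior x \<omega>) ` loc_hamiltonian A G \<rho> \<omega>"
    proof
      fix \<beta> assume b: "\<beta> \<in> cocycles A G \<rho> 1"
      then obtain x where "x \<in> carrier G" "interior x \<omega> = \<beta>"
        using omega_nondegenerate[of \<beta>] unfolding cocycles_def by blast
      then show "\<beta> \<in> (\<lambda>x. interior x \<omega>) ` loc_hamiltonian A G \<rho> \<omega>"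
        using b loc_hamiltonian_iff by blast
    qed
  qed (auto simp: loc_hamiltonian_iff)
  moreover have "Obs A G \<rho> \<omega> ` loc_hamiltonian A G \<rho> \<omega> =
      cohomology_class A G \<rho> 1 ` (\<lambda>x. interior x \<omega>) ` loc_hamiltonian A G \<rho> \<omega>"
    unfolding image_image by (intro image_cong refl) (simp only: Obs_def)
  ultimately have "Obs A G \<rho> \<omega> ` loc_hamiltonian A G \<rho> \<omega> = cohomology_class A G \<rho> 1 ` cocycles A G \<rho> 1"
    by simp
  also have "\<dots> = carrier (cohomology A G \<rho> 1)"
    by (auto simp: cohomology_1_fields cohomology_class_def A_RCOSETS_def RCOSETS_def a_r_coset_def
        cocycle_space_def simp del: One_nat_def)
  finally show ?thesis .
qed

text \<open>Linearity is that of \<open>x \<mapsto> i\<^sub>x\<omega>\<close> and of the quotient map. The bracket condition holds because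
  brackets are Hamiltonian and so have the zero class.\<close>

lemma Obs_lie_hom: "Obs A G \<rho> \<omega> \<in> lie_hom K (ham_loc_lie A G \<rho> \<omega>) (cohomology A G \<rho> 1)"
proof -
  interpret B: abelian_subgroup "coboundaries A G \<rho> 1" "cocycle_space A G \<rho> 1"
    by (rule coboundaries_1_subgroup)
  have car: "x \<in> carrier G" "interior x \<omega> \<in> carrier (cocycle_space A G \<rho> 1)"
    if "x \<in> loc_hamiltonian A G \<rho> \<omega>" for x
    using that by (auto simp: loc_hamiltonian_iff cocycle_space_def)
  have "Obs A G \<rho> \<omega> (x \<oplus>\<^bsub>G\<^esub> y) = Obs A G \<rho> \<omega> x \<oplus>\<^bsub>cohomology A G \<rho> 1\<^esub> Obs A G \<rho> \<omega> y"
    if "x \<in> loc_hamiltonian A G \<rho> \<omega>" "y \<in> loc_hamiltonian A G \<rho> \<omega>" for x y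
    using that[THEN car(1)] that[THEN car(2)]
    by (simp only: Obs_def cohomology_class_def cohomology_1_fields interior_add B.a_rcos_sum)
  moreover have "Obs A G \<rho> \<omega> ((k \<odot>\<^bsub>A\<^esub> \<one>\<^bsub>A\<^esub>) \<odot>\<^bsub>G\<^esub> x) = k \<odot>\<^bsub>cohomology A G \<rho> 1\<^esub> Obs A G \<rho> \<omega> x"
    if "x \<in> loc_hamiltonian A G \<rho> \<omega>" "k \<in> carrier K" for x k
    using that(2) car[OF that(1)]
    by (simp only: Obs_def cohomology_class_def interior_smult cohomology_1_smult)
  moreover have "Obs A G \<rho> \<omega> (lie_bracket G x y) =
      lie_bracket (cohomology A G \<rho> 1) (Obs A G \<rho> \<omega> x) (Obs A G \<rho> \<omega> y)"
    if "x \<in> loc_hamiltonian A G \<rho> \<omega>" "y \<in> loc_hamiltonian A G \<rho> \<omega>" for x y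
    using bracket_hamiltonian[OF that] hamiltonian_subset Obs_zero_iff
    unfolding cohomology_1_fields by blast
  moreover have "Obs A G \<rho> \<omega> \<in> loc_hamiltonian A G \<rho> \<omega> \<rightarrow> carrier (cohomology A G \<rho> 1)"
    using Obs_image by blast
  ultimately show ?thesis
    by (simp add: lie_hom_def linear_maps_def ham_loc_lie_def restrict_scalars_def del: One_nat_def)
qed

text \<open>Write \<open>u = x + f e\<close> and \<open>v = y + g e\<close>. Then \<open>d\<eta>(u, v) = \<rho>(x)(g) - \<rho>(y)(f) - \<eta>([u, v]) = - \<omega>(x, y)\<close>,
  since \<open>\<eta>\<close> reads off from \<open>[u, v]\<close> the same derivative terms. Moreover \<open>i\<^sub>u\<eta> = f\<close>, so
  \<open>(d i\<^sub>u\<eta>)(v) = \<rho>(y)(f)\<close>. The sum vanishes for all \<open>v\<close> exactly when \<open>i\<^sub>x\<omega> = df\<close>.\<close>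

lemma strict_symmetry_iff:
  assumes x: "x \<in> carrier G" and f: "f \<in> carrier A"
  shows "strict_symmetry A G \<rho> \<omega> (x, f) \<longleftrightarrow> interior x \<omega> = differential A G \<rho> (const_cochain A f)"
proof -
  let ?E = "extension A G \<rho> \<omega>" and ?\<rho> = "ext_anchor \<rho> :: 'g \<times> 'a \<Rightarrow> 'a \<Rightarrow> 'a"
    and ?\<eta> = "canonical_form A G"
  have carE: "carrier ?E = carrier G \<times> carrier A" by (simp add: extension_def)
  have E: "anchored_bracket A ?E ?\<rho>"
    by (intro anchored_bracket.intro anchored_bracket_axioms.intro)
      (use cring.axioms(1)[OF A_cring] anchor_in anchor_null lie_bracket_in omega_in in
        \<open>auto simp: extension_def ext_anchor_def\<close>)
  have \<eta>: "?\<eta> us \<in> carrier A" for us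
    by (auto simp: canonical_form_def length_Suc_conv)
  have i\<eta>: "interior (x, f) ?\<eta> us \<in> carrier A" for us
    unfolding interior_def by (rule \<eta>)
  have u: "(x, f) \<in> carrier ?E" using x f carE by simp
  have pair: "lie_derivative A ?E ?\<rho> (x, f) ?\<eta> [(y, g)] = \<rho> y f \<ominus>\<^bsub>A\<^esub> \<omega> [x, y]"
    if y: "y \<in> carrier G" and g: "g \<in> carrier A" for y g
  proof -
    have v: "(y, g) \<in> carrier ?E" using y g carE by simp
    have "differential A ?E ?\<rho> ?\<eta> [(x, f), (y, g)] =
        \<rho> x g \<ominus>\<^bsub>A\<^esub> \<rho> y f \<ominus>\<^bsub>A\<^esub> ((\<rho> x g \<ominus>\<^bsub>A\<^esub> \<rho> y f) \<oplus>\<^bsub>A\<^esub> \<omega> [x, y])"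
      using anchored_bracket.differential_pair[OF E \<eta> u v] x y f g lie_bracket_in anchor_in omega_in
      by (simp add: canonical_form_def ext_anchor_def extension_def)
    also have "\<dots> = \<ominus>\<^bsub>A\<^esub> \<omega> [x, y]"
      using x y f g anchor_in omega_in
      by (simp add: M.minus_eq M.minus_add M.a_ac M.r_neg1 M.r_neg2)
    finally have 1: "differential A ?E ?\<rho> ?\<eta> [(x, f), (y, g)] = \<ominus>\<^bsub>A\<^esub> \<omega> [x, y]" .
    have 2: "differential A ?E ?\<rho> (interior (x, f) ?\<eta>) [(y, g)] = \<rho> y f"
      using anchored_bracket.differential_singleton[OF E i\<eta> v] x f
      by (simp add: interior_def canonical_form_def ext_anchor_def)
    show ?thesis
      unfolding lie_derivative_def add_cochain_def 2 using 1 x y f omega_in anchor_in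
      by (simp add: interior_def M.minus_eq M.a_ac)
  qed
  have off: "lie_derivative A ?E ?\<rho> (x, f) ?\<eta> us = \<zero>\<^bsub>A\<^esub>"
    if us: "us \<notin> (\<lambda>v. [v]) ` carrier ?E" for us
  proof -
    have "differential A ?E ?\<rho> ?\<eta> ((x, f) # us) = \<zero>\<^bsub>A\<^esub> \<and>
      differential A ?E ?\<rho> (interior (x, f) ?\<eta>) us = \<zero>\<^bsub>A\<^esub>"
    proof (cases "set us \<subseteq> carrier ?E")
      case True
      then have "length us \<noteq> 1" using us by (auto simp: length_Suc_conv)
      then show ?thesis
        using anchored_bracket.differential_off_degree[OF E, of 1 ?\<eta> "(x, f) # us"]
          anchored_bracket.differential_off_degree[OF E, of 0 "interior (x, f) ?\<eta>" us]
        by (auto simp: canonical_form_def interior_def)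
    next
      case False
      then show ?thesis
        using anchored_bracket.differential_outside[OF E] by auto
    qed
    then show ?thesis by (simp add: lie_derivative_def add_cochain_def interior_def)
  qed
  have "strict_symmetry A G \<rho> \<omega> (x, f) \<longleftrightarrow>
      (\<forall>us. lie_derivative A ?E ?\<rho> (x, f) ?\<eta> us = \<zero>\<^bsub>A\<^esub>)"
    using u by (simp add: strict_symmetry_def zero_cochain_def fun_eq_iff)
  also have "\<dots> \<longleftrightarrow> (\<forall>y\<in>carrier G. \<rho> y f \<ominus>\<^bsub>A\<^esub> \<omega> [x, y] = \<zero>\<^bsub>A\<^esub>)" (is "?L \<longleftrightarrow> ?R")
  proof
    assume ?L
    then show ?R using pair[OF _ f] by simp
  next
    assume R: ?R
    show ?L
    proof
      fix us
      show "lie_derivative A ?E ?\<rho> (x, f) ?\<eta> us = \<zero>\<^bsub>A\<^esub>"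
      proof (cases "us \<in> (\<lambda>v. [v]) ` carrier ?E")
        case True
        then obtain y g where "us = [(y, g)]" "y \<in> carrier G" "g \<in> carrier A"
          using carE by auto
        then show ?thesis using pair R by simp
      qed (rule off)
    qed
  qed
  also have "\<dots> \<longleftrightarrow> (\<forall>y\<in>carrier G. interior x \<omega> [y] = differential A G \<rho> (const_cochain A f) [y])"
  proof (intro ball_cong refl)
    fix y assume y: "y \<in> carrier G"
    show "(\<rho> y f \<ominus>\<^bsub>A\<^esub> \<omega> [x, y] = \<zero>\<^bsub>A\<^esub>) \<longleftrightarrow>
        interior x \<omega> [y] = differential A G \<rho> (const_cochain A f) [y]"
      using M.minus_equality[of "\<rho> y f" "\<ominus>\<^bsub>A\<^esub> \<omega> [x, y]"] y f anchor_in omega_in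
      by (auto simp: interior_def differential_const_apply M.minus_eq M.r_neg)
  qed
  also have "\<dots> \<longleftrightarrow> interior x \<omega> = differential A G \<rho> (const_cochain A f)"
    using cochain_1_eqI[OF interior_cochain[OF x] differential_const_cochain[OF f]] by metis
  finally show ?thesis .
qed

lemma strict_lifting_iff:
  assumes "x \<in> carrier G"
  shows "(\<exists>f\<in>carrier A. strict_symmetry A G \<rho> \<omega> (x, f)) \<longleftrightarrow> x \<in> hamiltonian A G \<rho> \<omega>"
  unfolding hamiltonian_iff coboundaries_1 using assms strict_symmetry_iff by blast

lemma hamiltonian_exact_sequence:
  "lie_short_exact K (ham_lie A G \<rho> \<omega>) (\<lambda>x. x) (ham_loc_lie A G \<rho> \<omega>)
    (Obs A G \<rho> \<omega>) (cohomology A G \<rho> 1)"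
proof -
  have "(\<lambda>x. x) \<in> lie_hom K (ham_lie A G \<rho> \<omega>) (ham_loc_lie A G \<rho> \<omega>)"
    using hamiltonian_subset
    by (auto simp: lie_hom_def linear_maps_def ham_lie_def ham_loc_lie_def restrict_scalars_def)
  moreover have "hamiltonian A G \<rho> \<omega> =
      {x \<in> loc_hamiltonian A G \<rho> \<omega>. Obs A G \<rho> \<omega> x = \<zero>\<^bsub>cohomology A G \<rho> 1\<^esub>}"
    using Obs_zero_iff hamiltonian_subset unfolding cohomology_1_fields by blast
  ultimately show ?thesis
    using hamiltonian_lie loc_hamiltonian_lie cohomology_1_lie Obs_lie_hom Obs_image
    by (simp add: lie_short_exact_def ham_lie_def ham_loc_lie_def del: One_nat_def)
qed

end

theorem theorem7p2:
  fixes K :: "('k, 'm) ring_scheme"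
    and A :: "('k, 'a, 'n) module_scheme"
    and G :: "('a, 'g, 'o) lie_module_scheme"
    and \<rho> :: "'g \<Rightarrow> 'a \<Rightarrow> 'a"
    and \<omega> :: "'g list \<Rightarrow> 'a"
  assumes "symplectic_lrj_algebra K A G \<rho> \<omega>"
  shows "lie_algebra K (cohomology A G \<rho> 1) \<and> abelian_lie (cohomology A G \<rho> 1) \<and>
    Obs A G \<rho> \<omega> \<in> lie_hom K (ham_loc_lie A G \<rho> \<omega>) (cohomology A G \<rho> 1) \<and>
    Obs A G \<rho> \<omega> ` loc_hamiltonian A G \<rho> \<omega> = carrier (cohomology A G \<rho> 1) \<and>
    {x \<in> loc_hamiltonian A G \<rho> \<omega>. Obs A G \<rho> \<omega> x = \<zero>\<^bsub>cohomology A G \<rho> 1\<^esub>} = hamiltonian A G \<rho> \<omega> \<and>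
    lie_short_exact K (ham_lie A G \<rho> \<omega>) (\<lambda>x. x) (ham_loc_lie A G \<rho> \<omega>)
      (Obs A G \<rho> \<omega>) (cohomology A G \<rho> 1) \<and>
    (\<forall>x\<in>loc_hamiltonian A G \<rho> \<omega>.
      (\<exists>f\<in>carrier A. strict_symmetry A G \<rho> \<omega> (x, f)) \<longleftrightarrow>
        Obs A G \<rho> \<omega> x = \<zero>\<^bsub>cohomology A G \<rho> 1\<^esub>)"
proof -
  interpret symplectic_lrj_algebra K A G \<rho> \<omega> by (rule assms)
  have "abelian_lie (cohomology A G \<rho> 1)"
    unfolding abelian_lie_def cohomology_1_fields by blast
  moreover have zero: "Obs A G \<rho> \<omega> x = \<zero>\<^bsub>cohomology A G \<rho> 1\<^esub> \<longleftrightarrow> x \<in> hamiltonian A G \<rho> \<omega>"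
    if "x \<in> loc_hamiltonian A G \<rho> \<omega>" for x
    using Obs_zero_iff[OF that] unfolding cohomology_1_fields .
  moreover have "{x \<in> loc_hamiltonian A G \<rho> \<omega>. Obs A G \<rho> \<omega> x = \<zero>\<^bsub>cohomology A G \<rho> 1\<^esub>} =
      hamiltonian A G \<rho> \<omega>"
    using zero hamiltonian_subset by blast
  moreover have "(\<exists>f\<in>carrier A. strict_symmetry A G \<rho> \<omega> (x, f)) \<longleftrightarrow>
      Obs A G \<rho> \<omega> x = \<zero>\<^bsub>cohomology A G \<rho> 1\<^esub>" if "x \<in> loc_hamiltonian A G \<rho> \<omega>" for x
    using zero[OF that] strict_lifting_iff that unfolding loc_hamiltonian_iff by blast
  ultimately show ?thesis
    using cohomology_1_lie Obs_lie_hom Obs_image hamiltonian_exact_sequence by blast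
qed

end
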